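(* Let $(M,\tau)$ be a noncommutative, faithful, tracial probability space and let $(x_i)_{i\in\mathbb{N}}$ be a sequence of free, identically distributed, self-adjoint random variables in $(M,\tau)$. Let $s_k:=x_1+\cdots+x_k$ for every positive integer $k$. Then for all positive integers $m\le n$, $$\Phi\left(\frac{s_n}{\sqrt n}\right)\le\Phi\left(\frac{s_m}{\sqrt m}\right),$$ where $\Phi$ denotes the free Fisher information.
   Context: A noncommutative, faithful, tracial probability space $(M,\tau)$ is a unital $*$-algebra $M$ over $\mathbb{C}$ with a linear form $\tau:M\to\mathbb{C}$ satisfying $\tau(x^* )=\overline{\tau(x)}$, $\tau(1)=1$, $\tau(xy)=\tau(yx)$, $\tau(x^*x)\ge 0$ for all $x,y\in M$, and $\tau(x^*x)=0$ if and only if $x=0$. Unital sub-algebras $M_1,M_2,\ldots\subseteq M$ are free if $\tau(a_1\cdots a_r)=0$ whenever $r\geq 1$, $a_j\in M_{i_j}$, $\tau(a_j)=0$ for all $j$, and $i_1\ne i_2,\ldots,i_{r-1}\ne i_r$. Random variables are free if the unital sub-$*$-algebras they generate are free. Identically distributed means $\tau(x_i^r)$ does not depend on $i$, for every $r\ge 1$. $L^2(M)$ is the Hilbert space completion of $M$ for $\langle x,y\rangle:=\tau(x^*y)$, with norm $\|x\|_2=\sqrt{\langle x,x\rangle}$. For self-adjoint $z\in M$, $L^2(z)$ is the closure in $L^2(M)$ of the algebra of polynomials in $z$. A conjugate variable of $z$ is an element $\xi\in L^2(z)$ such that for every integer $r\ge 0$, $$\tau(\xi z^r)=\sum_{k=0}^{r-1}\tau(z^k)\,\tau(z^{r-1-k}),$$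 where $\tau(\xi z^r)$ means $\langle z^r,\xi\rangle$ (the sum is $0$ for $r=0$); it is unique when it exists. The free Fisher information of $z$ is $\Phi(z):=\|\xi\|_2^2$ if a conjugate variable $\xi$ exists, and $\Phi(z):=\infty$ otherwise. *)

theory Defs
  imports "HOL-Analysis.Analysis"
begin

locale star_algebra = vector_space scale
  for scale :: "complex \<Rightarrow> 'a::ring_1 \<Rightarrow> 'a" +
  fixes star :: "'a \<Rightarrow> 'a"
  assumes scale_mult_left: "scale c x * y = scale c (x * y)"
    and scale_mult_right: "x * scale c y = scale c (x * y)"
    and star_star: "star (star x) = x"
    and star_add: "star (x + y) = star x + star y"
    and star_scale: "star (scale c x) = scale (cnj c) (star x)"
    and star_mult: "star (x * y) = star y * star x"
begin

definition unital_star_subalgebra :: "'a set \<Rightarrow> bool" where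
  "unital_star_subalgebra A \<longleftrightarrow>
     1 \<in> A \<and> (\<forall>x\<in>A. \<forall>y\<in>A. x + y \<in> A \<and> x * y \<in> A) \<and>
     (\<forall>c. \<forall>x\<in>A. scale c x \<in> A) \<and> (\<forall>x\<in>A. star x \<in> A)"

definition generated_star_algebra :: "'a set \<Rightarrow> 'a set" where
  "generated_star_algebra S = unital_star_subalgebra hull S"

definition polynomials_in :: "'a \<Rightarrow> 'a set" where
  "polynomials_in z = {\<Sum>k<n. scale (c k) (z ^ k) | c (n::nat). True}"

end

locale tracial_space = star_algebra scale star
  for scale :: "complex \<Rightarrow> 'a::ring_1 \<Rightarrow> 'a" and star :: "'a \<Rightarrow> 'a" +
  fixes \<tau> :: "'a \<Rightarrow> complex"
  assumes tau_linear: "Vector_Spaces.linear scale (*) \<tau>"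
    and tau_star: "\<tau> (star x) = cnj (\<tau> x)"
    and tau_one: "\<tau> 1 = 1"
    and tau_trace: "\<tau> (x * y) = \<tau> (y * x)"
    and tau_nonneg: "\<tau> (star x * x) \<in> nonneg_Reals"
    and tau_faithful: "\<tau> (star x * x) = 0 \<longleftrightarrow> x = 0"
begin

definition free_subalgebras :: "'i set \<Rightarrow> ('i \<Rightarrow> 'a set) \<Rightarrow> bool" where
  "free_subalgebras I A \<longleftrightarrow>
     (\<forall>r\<ge>1. \<forall>(i :: nat \<Rightarrow> 'i) (a :: nat \<Rightarrow> 'a).
        (\<forall>j<r. i j \<in> I \<and> a j \<in> A (i j) \<and> \<tau> (a j) = 0) \<longrightarrow>
        (\<forall>j. Suc j < r \<longrightarrow> i j \<noteq> i (Suc j)) \<longrightarrow>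
        \<tau> (prod_list (map a [0..<r])) = 0)"

definition free_variables :: "'i set \<Rightarrow> ('i \<Rightarrow> 'a) \<Rightarrow> bool" where
  "free_variables I x \<longleftrightarrow> free_subalgebras I (\<lambda>i. generated_star_algebra {x i})"

definition identically_distributed :: "'i set \<Rightarrow> ('i \<Rightarrow> 'a) \<Rightarrow> bool" where
  "identically_distributed I x \<longleftrightarrow>
     (\<forall>i\<in>I. \<forall>j\<in>I. \<forall>r\<ge>1. \<tau> (x i ^ r) = \<tau> (x j ^ r))"

definition ip :: "'a \<Rightarrow> 'a \<Rightarrow> complex" where
  "ip x y = \<tau> (star x * y)"

definition norm2 :: "'a \<Rightarrow> real" where
  "norm2 x = sqrt (Re (ip x x))"

subsection \<open>The completion\<close>

text \<open>
  The completion depends on the parameters of the locale, so it is a set rather than a type: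
  its points are the classes of Cauchy sequences in the algebra modulo sequences that tend to zero.
\<close>

definition cauchy2 :: "(nat \<Rightarrow> 'a) set" where
  "cauchy2 = {X. \<forall>e>0. \<exists>N. \<forall>m\<ge>N. \<forall>n\<ge>N. norm2 (X m - X n) < e}"

definition equiv2 :: "((nat \<Rightarrow> 'a) \<times> (nat \<Rightarrow> 'a)) set" where
  "equiv2 = {(X, Y). X \<in> cauchy2 \<and> Y \<in> cauchy2 \<and> (\<lambda>n. norm2 (X n - Y n)) \<longlonglongrightarrow> 0}"

definition L2 :: "(nat \<Rightarrow> 'a) set set" where
  "L2 = cauchy2 // equiv2"

definition L2_class :: "(nat \<Rightarrow> 'a) \<Rightarrow> (nat \<Rightarrow> 'a) set" where
  "L2_class X = equiv2 `` {X}"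

definition L2_rep :: "(nat \<Rightarrow> 'a) set \<Rightarrow> nat \<Rightarrow> 'a" where
  "L2_rep \<xi> = (SOME X. X \<in> \<xi>)"

definition L2_embed :: "'a \<Rightarrow> (nat \<Rightarrow> 'a) set" where
  "L2_embed x = L2_class (\<lambda>_. x)"

definition L2_inner :: "(nat \<Rightarrow> 'a) set \<Rightarrow> (nat \<Rightarrow> 'a) set \<Rightarrow> complex" where
  "L2_inner \<xi> \<eta> = lim (\<lambda>n. ip (L2_rep \<xi> n) (L2_rep \<eta> n))"

definition L2_norm :: "(nat \<Rightarrow> 'a) set \<Rightarrow> real" where
  "L2_norm \<xi> = sqrt (Re (L2_inner \<xi> \<xi>))"

definition L2_diff :: "(nat \<Rightarrow> 'a) set \<Rightarrow> (nat \<Rightarrow> 'a) set \<Rightarrow> (nat \<Rightarrow> 'a) set" where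
  "L2_diff \<xi> \<eta> = L2_class (\<lambda>n. L2_rep \<xi> n - L2_rep \<eta> n)"

definition L2_dist :: "(nat \<Rightarrow> 'a) set \<Rightarrow> (nat \<Rightarrow> 'a) set \<Rightarrow> real" where
  "L2_dist \<xi> \<eta> = L2_norm (L2_diff \<xi> \<eta>)"

lemma tau_add: "\<tau> (x + y) = \<tau> x + \<tau> y"
  and tau_scale: "\<tau> (scale c x) = c * \<tau> x"
proof -
  interpret t: Vector_Spaces.linear scale "(*)" \<tau> by (rule tau_linear)
  show "\<tau> (x + y) = \<tau> x + \<tau> y" "\<tau> (scale c x) = c * \<tau> x"
    by (rule t.add t.scale)+
qed

lemma ip_add_left: "ip (x + y) z = ip x z + ip y z"
  and ip_add_right: "ip x (y + z) = ip x y + ip x z"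
  and ip_scale_left: "ip (scale c x) y = cnj c * ip x y"
  and ip_scale_right: "ip x (scale c y) = c * ip x y"
  and ip_commute: "ip y x = cnj (ip x y)"
  by (simp_all add: ip_def star_add star_scale tau_add tau_scale scale_mult_left
      scale_mult_right distrib_left distrib_right star_star star_mult flip: tau_star)

lemma ip_minus_left: "ip (- x) y = - ip x y"
  and ip_minus_right: "ip x (- y) = - ip x y"
  using ip_scale_left[of "- 1" x y] ip_scale_right[of x "- 1" y] by simp_all

lemma ip_diff_left: "ip (x - y) z = ip x z - ip y z"
  and ip_diff_right: "ip x (y - z) = ip x y - ip x z"
  using ip_add_left[of x "- y" z] ip_add_right[of x y "- z"]
  by (simp_all add: ip_minus_left ip_minus_right)

lemma ip_sum_left: "ip (\<Sum>k\<in>K. f k) y = (\<Sum>k\<in>K. ip (f k) y)"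
proof (induction K rule: infinite_finite_induct)
  case (insert k K)
  then show ?case by (simp add: ip_add_left)
qed (use ip_add_left[of 0 0 y] in auto)

lemma ip_self: "ip x x = complex_of_real ((norm2 x)\<^sup>2)" and norm2_nonneg: "0 \<le> norm2 x"
proof -
  obtain r where "0 \<le> r" "ip x x = complex_of_real r"
    using tau_nonneg[of x] unfolding ip_def by (rule nonneg_Reals_cases)
  then show "ip x x = complex_of_real ((norm2 x)\<^sup>2)" "0 \<le> norm2 x"
    by (simp_all add: norm2_def)
qed

lemma norm2_eq_0: "norm2 x = 0 \<longleftrightarrow> x = 0"
  using ip_self[of x] tau_faithful[of x] by (auto simp: ip_def)

lemma norm2_minus: "norm2 (- x) = norm2 x"
  by (simp add: norm2_def ip_minus_left ip_minus_right)

lemma norm2_commute: "norm2 (x - y) = norm2 (y - x)"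
  using norm2_minus[of "x - y"] by simp

lemma Cauchy_Schwarz2: "cmod (ip x y) \<le> norm2 x * norm2 y"
proof (cases "y = 0")
  case True
  then show ?thesis using ip_diff_right[of x 0 0] norm2_nonneg by simp
next
  case False
  then have pos: "0 < norm2 y"
    using norm2_eq_0[of y] norm2_nonneg[of y] by linarith
  define c where "c = ip y x / ip y y"
  have "ip (x - scale c y) (x - scale c y)
      = ip x x - c * ip x y - cnj c * ip y x + cnj c * c * ip y y"
    by (simp add: ip_diff_left ip_diff_right ip_scale_left ip_scale_right algebra_simps)
  also have "\<dots> = ip x x - ip y x * cnj (ip y x) / ip y y"
    using pos by (simp add: c_def ip_self[of y] ip_commute[of x y] field_simps)
  also have "\<dots> = complex_of_real ((norm2 x)\<^sup>2 - (cmod (ip y x))\<^sup>2 / (norm2 y)\<^sup>2)"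
    by (simp add: ip_self complex_norm_square[symmetric])
  finally have "0 \<le> (norm2 x)\<^sup>2 - (cmod (ip y x))\<^sup>2 / (norm2 y)\<^sup>2"
    unfolding ip_self of_real_eq_iff by (metis zero_le_power2)
  then have "(cmod (ip y x))\<^sup>2 \<le> (norm2 x * norm2 y)\<^sup>2"
    using pos by (simp add: field_simps)
  then have "cmod (ip y x) \<le> norm2 x * norm2 y"
    by (rule power2_le_imp_le) (simp add: norm2_nonneg)
  then show ?thesis by (simp add: ip_commute[of x y])
qed

lemma norm2_triangle: "norm2 (x + y) \<le> norm2 x + norm2 y"
proof (rule power2_le_imp_le)
  have "complex_of_real ((norm2 (x + y))\<^sup>2) = ip x x + ip y y + (ip x y + cnj (ip x y))"
    unfolding ip_self[symmetric]
    by (simp add: ip_add_left ip_add_right ip_commute[of y x])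
  then have "(norm2 (x + y))\<^sup>2 = (norm2 x)\<^sup>2 + (norm2 y)\<^sup>2 + 2 * Re (ip x y)"
    by (simp add: ip_self complex_eq_iff)
  also have "Re (ip x y) \<le> norm2 x * norm2 y"
    using Cauchy_Schwarz2[of x y] complex_Re_le_cmod[of "ip x y"] by linarith
  finally show "(norm2 (x + y))\<^sup>2 \<le> (norm2 x + norm2 y)\<^sup>2"
    by (simp add: power2_sum)
qed (simp add: norm2_nonneg)

lemma norm2_triangle_diff: "norm2 (x - z) \<le> norm2 (x - y) + norm2 (y - z)"
  using norm2_triangle[of "x - y" "y - z"] by simp

lemma norm2_reverse: "\<bar>norm2 x - norm2 y\<bar> \<le> norm2 (x - y)"
  using norm2_triangle[of "x - y" y] norm2_triangle[of "y - x" x] norm2_commute[of x y] by simp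

lemma cauchy2_diff:
  assumes "X \<in> cauchy2" "Y \<in> cauchy2"
  shows "(\<lambda>n. X n - Y n) \<in> cauchy2"
  unfolding cauchy2_def
proof (clarify)
  fix e :: real assume "0 < e"
  then obtain N1 N2 where N: "\<forall>m\<ge>N1. \<forall>n\<ge>N1. norm2 (X m - X n) < e / 2"
    "\<forall>m\<ge>N2. \<forall>n\<ge>N2. norm2 (Y m - Y n) < e / 2"
    using assms half_gt_zero[OF \<open>0 < e\<close>] unfolding cauchy2_def by blast
  have "norm2 (X m - Y m - (X n - Y n)) < e" if "m \<ge> max N1 N2" "n \<ge> max N1 N2" for m n
  proof -
    have "norm2 (X m - X n) < e / 2" "norm2 (Y n - Y m) < e / 2"
      using N that by auto
    then show ?thesis
      using norm2_triangle[of "X m - X n" "Y n - Y m"] by (simp add: algebra_simps)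
  qed
  then show "\<exists>N. \<forall>m\<ge>N. \<forall>n\<ge>N. norm2 (X m - Y m - (X n - Y n)) < e" by blast
qed

lemma cauchy2_norm2_convergent:
  assumes "X \<in> cauchy2"
  shows "convergent (\<lambda>n. norm2 (X n))"
  unfolding Cauchy_convergent_iff[symmetric]
proof (rule CauchyI)
  fix e :: real assume "0 < e"
  then obtain N where "\<forall>m\<ge>N. \<forall>n\<ge>N. norm2 (X m - X n) < e"
    using assms unfolding cauchy2_def by blast
  then show "\<exists>M. \<forall>m\<ge>M. \<forall>n\<ge>M. norm (norm2 (X m) - norm2 (X n)) < e"
    using norm2_reverse by (metis le_less_trans real_norm_def)
qed

lemma cauchy2_scale:
  assumes "X \<in> cauchy2"
  shows "(\<lambda>n. scale c (X n)) \<in> cauchy2"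
proof -
  have eq: "norm2 (scale c x - scale c y) = cmod c * norm2 (x - y)" for x y
  proof -
    have "complex_of_real ((norm2 (scale c (x - y)))\<^sup>2) = c * cnj c * ip (x - y) (x - y)"
      unfolding ip_self[symmetric] by (simp add: ip_scale_left ip_scale_right)
    also have "\<dots> = complex_of_real ((cmod c * norm2 (x - y))\<^sup>2)"
      by (simp add: ip_self complex_norm_square[symmetric] power_mult_distrib)
    finally have "(norm2 (scale c (x - y)))\<^sup>2 = (cmod c * norm2 (x - y))\<^sup>2"
      unfolding of_real_eq_iff .
    then have "norm2 (scale c (x - y)) = cmod c * norm2 (x - y)"
      by (rule power2_eq_imp_eq) (simp_all add: norm2_nonneg)
    then show ?thesis by (simp add: scale_right_diff_distrib)
  qed
  show ?thesis
  proof (cases "c = 0")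
    case True
    then show ?thesis by (simp add: cauchy2_def norm2_eq_0[THEN iffD2])
  next
    case False
    show ?thesis unfolding cauchy2_def
    proof clarify
      fix e :: real assume "0 < e"
      then have "0 < e / cmod c" using False by simp
      then obtain N where "\<forall>m\<ge>N. \<forall>n\<ge>N. norm2 (X m - X n) < e / cmod c"
        using assms unfolding cauchy2_def by blast
      then show "\<exists>N. \<forall>m\<ge>N. \<forall>n\<ge>N. norm2 (scale c (X m) - scale c (X n)) < e"
        using False by (auto simp: eq field_simps)
    qed
  qed
qed

lemma cauchy2_add:
  assumes "X \<in> cauchy2" "Y \<in> cauchy2"
  shows "(\<lambda>n. X n + Y n) \<in> cauchy2"
  using cauchy2_diff[OF assms(1) cauchy2_scale[OF assms(2), of "- 1"]] by simp

text \<open>Polarisation reduces the convergence of inner products to the convergence of norms.\<close>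

lemma ip_convergent:
  assumes "X \<in> cauchy2" "Y \<in> cauchy2"
  shows "convergent (\<lambda>n. ip (X n) (Y n))"
proof -
  have polar: "ip x y = (complex_of_real ((norm2 (x + y))\<^sup>2) - complex_of_real ((norm2 (x - y))\<^sup>2)
      - \<i> * (complex_of_real ((norm2 (x + scale \<i> y))\<^sup>2)
             - complex_of_real ((norm2 (x - scale \<i> y))\<^sup>2))) / 4" for x y
    unfolding ip_self[symmetric]
    by (simp add: ip_add_left ip_add_right ip_diff_left ip_diff_right ip_scale_left
        ip_scale_right algebra_simps)
  note conv = cauchy2_norm2_convergent
  have "\<exists>a. (\<lambda>n. norm2 (X n + Y n)) \<longlonglongrightarrow> a" "\<exists>a. (\<lambda>n. norm2 (X n - Y n)) \<longlonglongrightarrow> a"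
    "\<exists>a. (\<lambda>n. norm2 (X n + scale \<i> (Y n))) \<longlonglongrightarrow> a" "\<exists>a. (\<lambda>n. norm2 (X n - scale \<i> (Y n))) \<longlonglongrightarrow> a"
    using conv[OF cauchy2_add[OF assms]] conv[OF cauchy2_diff[OF assms]]
      conv[OF cauchy2_add[OF assms(1) cauchy2_scale[OF assms(2)]]]
      conv[OF cauchy2_diff[OF assms(1) cauchy2_scale[OF assms(2)]]]
    by (auto simp: convergent_def)
  then obtain a b c d where lims: "(\<lambda>n. norm2 (X n + Y n)) \<longlonglongrightarrow> a" "(\<lambda>n. norm2 (X n - Y n)) \<longlonglongrightarrow> b"
    "(\<lambda>n. norm2 (X n + scale \<i> (Y n))) \<longlonglongrightarrow> c" "(\<lambda>n. norm2 (X n - scale \<i> (Y n))) \<longlonglongrightarrow> d"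
    by blast
  show ?thesis
    unfolding convergent_def polar by (rule exI, (rule tendsto_intros lims | simp)+)
qed

lemma equiv2: "equiv cauchy2 equiv2"
proof (rule equivI)
  show "equiv2 \<subseteq> cauchy2 \<times> cauchy2" by (auto simp: equiv2_def)
  show "refl_on cauchy2 equiv2" by (auto simp: refl_on_def equiv2_def norm2_eq_0[THEN iffD2])
  show "sym equiv2" by (auto simp: sym_def equiv2_def norm2_commute)
  show "trans equiv2"
  proof (rule transI)
    fix X Y Z assume *: "(X, Y) \<in> equiv2" "(Y, Z) \<in> equiv2"
    then have "(\<lambda>n. norm2 (X n - Y n) + norm2 (Y n - Z n)) \<longlonglongrightarrow> 0"
      using tendsto_add[of "\<lambda>n. norm2 (X n - Y n)" 0] by (fastforce simp: equiv2_def)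
    then have "(\<lambda>n. norm2 (X n - Z n)) \<longlonglongrightarrow> 0"
      by (rule tendsto_sandwich[OF _ _ tendsto_const, rotated 2])
        (auto simp: norm2_nonneg norm2_triangle_diff)
    with * show "(X, Z) \<in> equiv2" by (auto simp: equiv2_def)
  qed
qed

lemma L2_cases:
  assumes "\<xi> \<in> L2"
  obtains X where "X \<in> cauchy2" "\<xi> = L2_class X"
  using assms unfolding L2_def L2_class_def by (auto elim: quotientE)

lemma L2_class_in: "X \<in> cauchy2 \<Longrightarrow> L2_class X \<in> L2"
  unfolding L2_def L2_class_def by (rule quotientI)

lemma L2_class_eq:
  assumes "X \<in> cauchy2" "Y \<in> cauchy2"
  shows "L2_class X = L2_class Y \<longleftrightarrow> (\<lambda>n. norm2 (X n - Y n)) \<longlonglongrightarrow> 0"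
  using eq_equiv_class_iff[OF equiv2 assms] assms by (simp add: L2_class_def equiv2_def)

lemma L2_rep_equiv: "X \<in> cauchy2 \<Longrightarrow> (X, L2_rep (L2_class X)) \<in> equiv2"
  unfolding L2_rep_def L2_class_def
  using someI_ex[of "\<lambda>Y. Y \<in> equiv2 `` {X}"] equiv_class_self[OF equiv2] by blast

text \<open>Neither the inner product nor the difference depends on the representatives.\<close>

lemma L2_inner_class:
  assumes X: "X \<in> cauchy2" and Y: "Y \<in> cauchy2"
  shows "(\<lambda>n. ip (X n) (Y n)) \<longlonglongrightarrow> L2_inner (L2_class X) (L2_class Y)"
proof -
  define X' Y' where "X' = L2_rep (L2_class X)" and "Y' = L2_rep (L2_class Y)"
  have X': "X' \<in> cauchy2" "(\<lambda>n. norm2 (X n - X' n)) \<longlonglongrightarrow> 0"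
    and Y': "Y' \<in> cauchy2" "(\<lambda>n. norm2 (Y n - Y' n)) \<longlonglongrightarrow> 0"
    using L2_rep_equiv[OF X] L2_rep_equiv[OF Y] by (auto simp: equiv2_def X'_def Y'_def)
  obtain a b where ab: "(\<lambda>n. norm2 (X' n)) \<longlonglongrightarrow> a" "(\<lambda>n. norm2 (Y n)) \<longlonglongrightarrow> b"
    using cauchy2_norm2_convergent X' Y by (meson convergent_def)
  have lim: "(\<lambda>n. ip (X' n) (Y' n)) \<longlonglongrightarrow> L2_inner (L2_class X) (L2_class Y)"
    using ip_convergent[OF X'(1) Y'(1)] unfolding L2_inner_def X'_def Y'_def
    by (rule convergent_LIMSEQ_iff[THEN iffD1])
  have "(\<lambda>n. norm2 (X n - X' n) * norm2 (Y n) + norm2 (X' n) * norm2 (Y n - Y' n))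
      \<longlonglongrightarrow> 0 * b + a * 0"
    by (intro tendsto_intros X' Y' ab)
  then have to0: "(\<lambda>n. norm2 (X n - X' n) * norm2 (Y n) + norm2 (X' n) * norm2 (Y n - Y' n)) \<longlonglongrightarrow> 0"
    by simp
  have "(\<lambda>n. ip (X n) (Y n) - ip (X' n) (Y' n)) \<longlonglongrightarrow> 0"
  proof (rule Lim_null_comparison[OF always_eventually[OF allI] to0])
    fix n
    have "ip (X n) (Y n) - ip (X' n) (Y' n) = ip (X n - X' n) (Y n) + ip (X' n) (Y n - Y' n)"
      by (simp add: ip_diff_left ip_diff_right)
    then show "norm (ip (X n) (Y n) - ip (X' n) (Y' n))
        \<le> norm2 (X n - X' n) * norm2 (Y n) + norm2 (X' n) * norm2 (Y n - Y' n)"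
      using norm_triangle_ineq[of "ip (X n - X' n) (Y n)" "ip (X' n) (Y n - Y' n)"]
        Cauchy_Schwarz2[of "X n - X' n" "Y n"] Cauchy_Schwarz2[of "X' n" "Y n - Y' n"] by simp
  qed
  from tendsto_add[OF this lim] show ?thesis by simp
qed

lemma L2_norm_class:
  assumes "X \<in> cauchy2"
  shows "(\<lambda>n. norm2 (X n)) \<longlonglongrightarrow> L2_norm (L2_class X)"
  unfolding L2_norm_def norm2_def
  by (intro tendsto_intros L2_inner_class assms)

lemma L2_diff_class:
  assumes X: "X \<in> cauchy2" and Y: "Y \<in> cauchy2"
  shows "L2_diff (L2_class X) (L2_class Y) = L2_class (\<lambda>n. X n - Y n)"
proof -
  define X' Y' where "X' = L2_rep (L2_class X)" and "Y' = L2_rep (L2_class Y)"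
  have X': "X' \<in> cauchy2" "(\<lambda>n. norm2 (X n - X' n)) \<longlonglongrightarrow> 0"
    and Y': "Y' \<in> cauchy2" "(\<lambda>n. norm2 (Y n - Y' n)) \<longlonglongrightarrow> 0"
    using L2_rep_equiv[OF X] L2_rep_equiv[OF Y] by (auto simp: equiv2_def X'_def Y'_def)
  have to0: "(\<lambda>n. norm2 (X n - X' n) + norm2 (Y n - Y' n)) \<longlonglongrightarrow> 0"
    using tendsto_add[OF X'(2) Y'(2)] by simp
  have "(\<lambda>n. norm2 (X' n - Y' n - (X n - Y n))) \<longlonglongrightarrow> 0"
  proof (rule Lim_null_comparison[OF always_eventually[OF allI] to0])
    fix n show "norm (norm2 (X' n - Y' n - (X n - Y n)))
        \<le> norm2 (X n - X' n) + norm2 (Y n - Y' n)"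
      using norm2_triangle[of "X' n - X n" "Y n - Y' n"] norm2_commute[of "X' n" "X n"]
      by (simp add: norm2_nonneg algebra_simps)
  qed
  then show ?thesis
    unfolding L2_diff_def X'_def[symmetric] Y'_def[symmetric]
    using L2_class_eq cauchy2_diff X Y X'(1) Y'(1) by blast
qed

lemma L2_dist_class:
  assumes "X \<in> cauchy2" "Y \<in> cauchy2"
  shows "(\<lambda>n. norm2 (X n - Y n)) \<longlonglongrightarrow> L2_dist (L2_class X) (L2_class Y)"
  using L2_norm_class[OF cauchy2_diff[OF assms]] L2_diff_class[OF assms]
  by (simp add: L2_dist_def)

lemma L2_dist_nonneg: "0 \<le> L2_dist \<xi> \<eta>" if \<xi>\<eta>: "\<xi> \<in> L2" "\<eta> \<in> L2"
proof -
  obtain X Y where XY: "X \<in> cauchy2" "\<xi> = L2_class X" "Y \<in> cauchy2" "\<eta> = L2_class Y"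
    using \<xi>\<eta> L2_cases by metis
  show ?thesis
    unfolding XY by (rule LIMSEQ_le_const[OF L2_dist_class[OF XY(1,3)]]) (simp add: norm2_nonneg)
qed

lemma L2_dist_eq_0: "L2_dist \<xi> \<eta> = 0 \<longleftrightarrow> \<xi> = \<eta>" if \<xi>\<eta>: "\<xi> \<in> L2" "\<eta> \<in> L2"
proof -
  obtain X Y where XY: "X \<in> cauchy2" "\<xi> = L2_class X" "Y \<in> cauchy2" "\<eta> = L2_class Y"
    using \<xi>\<eta> L2_cases by metis
  show ?thesis
    unfolding XY L2_class_eq[OF XY(1,3)] using L2_dist_class[OF XY(1,3)] LIMSEQ_unique by metis
qed

lemma L2_dist_triangle: "L2_dist \<xi> \<zeta> \<le> L2_dist \<xi> \<eta> + L2_dist \<eta> \<zeta>"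
  if \<xi>\<eta>\<zeta>: "\<xi> \<in> L2" "\<eta> \<in> L2" "\<zeta> \<in> L2"
proof -
  obtain X Y Z where XYZ: "X \<in> cauchy2" "\<xi> = L2_class X" "Y \<in> cauchy2" "\<eta> = L2_class Y"
    "Z \<in> cauchy2" "\<zeta> = L2_class Z"
    using \<xi>\<eta>\<zeta> L2_cases by metis
  show ?thesis
    unfolding XYZ
    by (rule LIMSEQ_le[OF L2_dist_class[OF XYZ(1,5)]
          tendsto_add[OF L2_dist_class[OF XYZ(1,3)] L2_dist_class[OF XYZ(3,5)]]])
      (simp add: norm2_triangle_diff)
qed

lemma L2_dist_commute: "L2_dist \<xi> \<eta> = L2_dist \<eta> \<xi>" if \<xi>\<eta>: "\<xi> \<in> L2" "\<eta> \<in> L2"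
proof -
  obtain X Y where XY: "X \<in> cauchy2" "\<xi> = L2_class X" "Y \<in> cauchy2" "\<eta> = L2_class Y"
    using \<xi>\<eta> L2_cases by metis
  show ?thesis
    using L2_dist_class[OF XY(1,3)] L2_dist_class[OF XY(3,1)] LIMSEQ_unique
    unfolding XY norm2_commute[of "Y _"] by blast
qed

lemma cauchy2_const: "(\<lambda>_. x) \<in> cauchy2"
  by (simp add: cauchy2_def norm2_eq_0[THEN iffD2])

lemma L2_embed_in: "L2_embed x \<in> L2"
  unfolding L2_embed_def by (rule L2_class_in[OF cauchy2_const])

lemma L2_inner_embed: "L2_inner (L2_embed x) (L2_embed y) = ip x y"
  using L2_inner_class[OF cauchy2_const cauchy2_const, of x y]
  by (simp add: L2_embed_def LIMSEQ_const_iff)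

lemma L2_dist_embed: "L2_dist (L2_embed x) (L2_embed y) = norm2 (x - y)"
  using L2_dist_class[OF cauchy2_const cauchy2_const, of x y]
  by (simp add: L2_embed_def LIMSEQ_const_iff)

lemma L2_dist_terms:
  assumes X: "X \<in> cauchy2"
  shows "(\<lambda>k. L2_dist (L2_class X) (L2_embed (X k))) \<longlonglongrightarrow> 0"
proof (rule LIMSEQ_I)
  fix e :: real assume "0 < e"
  then have "0 < e / 2" by simp
  then obtain N where N: "\<forall>m\<ge>N. \<forall>n\<ge>N. norm2 (X m - X n) < e / 2"
    using X unfolding cauchy2_def by blast
  have "norm (L2_dist (L2_class X) (L2_embed (X k)) - 0) < e" if "k \<ge> N" for k
  proof -
    have "L2_dist (L2_class X) (L2_embed (X k)) \<le> e / 2"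
      unfolding L2_embed_def
      by (rule LIMSEQ_le_const2[OF L2_dist_class[OF X cauchy2_const]])
        (use N that in \<open>auto intro!: exI[of _ N] less_imp_le\<close>)
    then show ?thesis
      using \<open>0 < e\<close> L2_dist_nonneg[OF L2_class_in[OF X] L2_embed_in] by simp
  qed
  then show "\<exists>N. \<forall>k\<ge>N. norm (L2_dist (L2_class X) (L2_embed (X k)) - 0) < e" by blast
qed

lemma L2_dense:
  assumes "\<xi> \<in> L2" "0 < e"
  shows "\<exists>x. L2_dist \<xi> (L2_embed x) < e"
proof -
  obtain X where X: "X \<in> cauchy2" "\<xi> = L2_class X" using assms(1) by (rule L2_cases)
  show ?thesis
    using order_tendstoD(2)[OF L2_dist_terms[OF X(1)] assms(2)] X(2)
    by (auto simp: eventually_sequentially)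
qed

lemma L2_complete:
  assumes L2: "\<And>n. \<xi> n \<in> L2"
    and cauchy: "\<And>e. 0 < e \<Longrightarrow> \<exists>N. \<forall>m\<ge>N. \<forall>n\<ge>N. L2_dist (\<xi> m) (\<xi> n) < e"
  shows "\<exists>\<eta>\<in>L2. (\<lambda>n. L2_dist (\<xi> n) \<eta>) \<longlonglongrightarrow> 0"
proof -
  have "\<exists>x. L2_dist (\<xi> n) (L2_embed x) < 1 / real (Suc n)" for n
    by (rule L2_dense[OF L2]) simp
  then obtain X where X: "\<And>n. L2_dist (\<xi> n) (L2_embed (X n)) < 1 / real (Suc n)"
    by metis
  have X0: "(\<lambda>n. L2_dist (\<xi> n) (L2_embed (X n))) \<longlonglongrightarrow> 0"
    by (rule Lim_null_comparison[OF always_eventually[OF allI] LIMSEQ_Suc[OF lim_1_over_n]])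
      (use X L2_dist_nonneg[OF L2 L2_embed_in] in \<open>simp add: less_imp_le\<close>)
  have "X \<in> cauchy2"
    unfolding cauchy2_def
  proof clarify
    fix e :: real assume "0 < e"
    then have e3: "0 < e / 3" by simp
    obtain N1 where N1: "\<forall>m\<ge>N1. \<forall>n\<ge>N1. L2_dist (\<xi> m) (\<xi> n) < e / 3"
      using cauchy[OF e3] by blast
    obtain N2 where N2: "\<forall>n\<ge>N2. L2_dist (\<xi> n) (L2_embed (X n)) < e / 3"
      using order_tendstoD(2)[OF X0 e3] by (auto simp: eventually_sequentially)
    have "norm2 (X m - X n) < e" if "m \<ge> max N1 N2" "n \<ge> max N1 N2" for m n
    proof -
      have "L2_dist (\<xi> m) (\<xi> n) < e / 3" "L2_dist (\<xi> m) (L2_embed (X m)) < e / 3"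
        "L2_dist (\<xi> n) (L2_embed (X n)) < e / 3"
        using N1 N2 that by auto
      then show ?thesis
        using L2_dist_triangle[OF L2_embed_in[of "X m"] L2[of m] L2_embed_in[of "X n"]]
          L2_dist_triangle[OF L2[of m] L2[of n] L2_embed_in[of "X n"]]
          L2_dist_commute[OF L2[of m] L2_embed_in[of "X m"]]
        by (simp add: L2_dist_embed)
    qed
    then show "\<exists>N. \<forall>m\<ge>N. \<forall>n\<ge>N. norm2 (X m - X n) < e" by blast
  qed
  note eta = L2_class_in[OF this]
  have to0: "(\<lambda>n. L2_dist (\<xi> n) (L2_embed (X n)) + L2_dist (L2_class X) (L2_embed (X n))) \<longlonglongrightarrow> 0"
    using tendsto_add[OF X0 L2_dist_terms[OF \<open>X \<in> cauchy2\<close>]] by simp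
  have "(\<lambda>n. L2_dist (\<xi> n) (L2_class X)) \<longlonglongrightarrow> 0"
    by (rule Lim_null_comparison[OF always_eventually[OF allI] to0])
      (use L2_dist_nonneg[OF L2 eta] L2_dist_triangle[OF L2 L2_embed_in eta]
        L2_dist_commute[OF eta L2_embed_in] in \<open>simp\<close>)
  with eta show ?thesis by blast
qed

subsection \<open>Conjugate variables and free Fisher information\<close>

definition L2_closure :: "(nat \<Rightarrow> 'a) set set \<Rightarrow> (nat \<Rightarrow> 'a) set set" where
  "L2_closure S = {\<xi> \<in> L2. \<forall>e>0. \<exists>\<eta>\<in>S. L2_dist \<xi> \<eta> < e}"

definition L2_of :: "'a \<Rightarrow> (nat \<Rightarrow> 'a) set set" where
  "L2_of z = L2_closure (L2_embed ` polynomials_in z)"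

text \<open>The pairing of a vector \<open>\<xi>\<close> with \<open>z ^ r\<close> under the trace is \<open>L2_inner (z ^ r) \<xi>\<close>,
  the inner product being linear in its second argument.\<close>

definition is_conjugate_variable :: "'a \<Rightarrow> (nat \<Rightarrow> 'a) set \<Rightarrow> bool" where
  "is_conjugate_variable z \<xi> \<longleftrightarrow> \<xi> \<in> L2_of z \<and>
     (\<forall>r. L2_inner (L2_embed (z ^ r)) \<xi> = (\<Sum>k<r. \<tau> (z ^ k) * \<tau> (z ^ (r - 1 - k))))"

definition free_Fisher :: "'a \<Rightarrow> ennreal" where
  "free_Fisher z =
     (if \<exists>\<xi>. is_conjugate_variable z \<xi>
      then ennreal ((L2_norm (THE \<xi>. is_conjugate_variable z \<xi>))\<^sup>2) else \<infinity>)"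

lemma conjugate_variable_unique:
  assumes \<xi>: "is_conjugate_variable z \<xi>" and \<eta>: "is_conjugate_variable z \<eta>"
  shows "\<xi> = \<eta>"
proof -
  have L2: "\<xi> \<in> L2" "\<eta> \<in> L2"
    using assms by (auto simp: is_conjugate_variable_def L2_of_def L2_closure_def)
  obtain X Y where XY: "X \<in> cauchy2" "\<xi> = L2_class X" "Y \<in> cauchy2" "\<eta> = L2_class Y"
    using L2 L2_cases by metis
  define d where "d = L2_dist \<xi> \<eta>"
  have D: "(\<lambda>n. norm2 (X n - Y n)) \<longlonglongrightarrow> d"
    using L2_dist_class[OF XY(1,3)] by (simp add: d_def XY)
  have power0: "(\<lambda>n. ip (z ^ r) (X n - Y n)) \<longlonglongrightarrow> 0" for r
  proof -
    have "(\<lambda>n. ip (z ^ r) (X n) - ip (z ^ r) (Y n))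
        \<longlonglongrightarrow> L2_inner (L2_embed (z ^ r)) \<xi> - L2_inner (L2_embed (z ^ r)) \<eta>"
      unfolding XY L2_embed_def by (intro tendsto_diff L2_inner_class cauchy2_const XY)
    then show ?thesis
      using assms by (simp add: is_conjugate_variable_def ip_diff_right)
  qed
  have poly0: "(\<lambda>n. ip p (X n - Y n)) \<longlonglongrightarrow> 0" if "p \<in> polynomials_in z" for p
  proof -
    from that obtain c N where p: "p = (\<Sum>k<N. scale (c k) (z ^ k))"
      by (auto simp: polynomials_in_def)
    have "(\<lambda>n. \<Sum>k<N. cnj (c k) * ip (z ^ k) (X n - Y n)) \<longlonglongrightarrow> (\<Sum>k<N. cnj (c k) * 0)"
      by (intro tendsto_intros power0)
    then show ?thesis by (simp add: p ip_sum_left ip_scale_left)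
  qed
  have "d * d \<le> 2 * e * d" if "0 < e" for e
  proof -
    obtain p where p: "p \<in> polynomials_in z" "L2_dist \<xi> (L2_embed p) < e"
      using \<xi> \<open>0 < e\<close> by (auto simp: is_conjugate_variable_def L2_of_def L2_closure_def)
    obtain q where q: "q \<in> polynomials_in z" "L2_dist \<eta> (L2_embed q) < e"
      using \<eta> \<open>0 < e\<close> by (auto simp: is_conjugate_variable_def L2_of_def L2_closure_def)
    have bound: "norm2 (X n - Y n) * norm2 (X n - Y n)
        \<le> (norm2 (X n - p) + norm2 (Y n - q)) * norm2 (X n - Y n)
          + cmod (ip p (X n - Y n)) + cmod (ip q (X n - Y n))" for n
    proof -
      define v where "v = X n - Y n"
      have "norm2 v * norm2 v = cmod (ip v v)"
        by (simp only: ip_self norm_of_real) (simp add: power2_eq_square)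
      also have "ip v v = ip (X n - p) v - ip (Y n - q) v + ip p v - ip q v"
        unfolding v_def by (simp add: ip_diff_left)
      also have "cmod \<dots> \<le> cmod (ip (X n - p) v) + cmod (ip (Y n - q) v) + cmod (ip p v) + cmod (ip q v)"
        by (intro norm_triangle_le norm_triangle_le_diff add_mono order_refl)
      also have "\<dots> \<le> norm2 (X n - p) * norm2 v + norm2 (Y n - q) * norm2 v + cmod (ip p v) + cmod (ip q v)"
        by (intro add_mono Cauchy_Schwarz2 order_refl)
      finally show ?thesis unfolding v_def by (simp add: distrib_right)
    qed
    have p_lim: "(\<lambda>n. norm2 (X n - p)) \<longlonglongrightarrow> L2_dist \<xi> (L2_embed p)"
      and q_lim: "(\<lambda>n. norm2 (Y n - q)) \<longlonglongrightarrow> L2_dist \<eta> (L2_embed q)"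
      unfolding XY L2_embed_def by (intro L2_dist_class cauchy2_const XY)+
    have "(\<lambda>n. (norm2 (X n - p) + norm2 (Y n - q)) * norm2 (X n - Y n)
          + cmod (ip p (X n - Y n)) + cmod (ip q (X n - Y n)))
        \<longlonglongrightarrow> (L2_dist \<xi> (L2_embed p) + L2_dist \<eta> (L2_embed q)) * d + cmod 0 + cmod 0"
      by (intro tendsto_intros D p_lim q_lim poly0 p(1) q(1))
    then have "d * d \<le> (L2_dist \<xi> (L2_embed p) + L2_dist \<eta> (L2_embed q)) * d + cmod 0 + cmod 0"
      using bound by (intro LIMSEQ_le[OF tendsto_mult[OF D D]]) auto
    also have "\<dots> \<le> 2 * e * d"
      using p q L2_dist_nonneg[OF L2] by (simp add: d_def mult_right_mono)
    finally show ?thesis .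
  qed
  from this[of "d / 4"] have "d = 0"
    using L2_dist_nonneg[OF L2] by (cases "d = 0") (auto simp: d_def mult_less_0_iff)
  then show ?thesis using L2_dist_eq_0[OF L2] by (simp add: d_def)
qed

end

end

theory Submission
  imports Defs
begin

text \<open>
  Let \<open>\<xi>\<close> be the conjugate variable of \<open>s = s\<^sub>m\<close>, and let \<open>t = s\<^sub>m\<^sub>+\<^sub>1\<close>.  As \<open>x\<^sub>m\<^sub>+\<^sub>1\<close> is free from \<open>s\<close>, the
  vector \<open>\<xi>\<close> pairs with the polynomials in \<open>t\<close> as the conjugate variable of \<open>t\<close> has to.  The maximal
  correlation between centered polynomials in \<open>s\<close> and polynomials in \<open>t\<close> is at most \<open>\<surd>(m / (m + 1))\<close>,
  so \<open>t\<close> has a conjugate variable, of norm at most \<open>\<surd>(m / (m + 1)) \<parallel>\<xi>\<parallel>\<close>; scaling and induction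
  give the claim.

  For the correlation bound, exchangeability replaces \<open>p(s)\<close> in \<open>\<langle>p(s), q(t)\<rangle>\<close> by the average of the
  \<open>m + 1\<close> elements \<open>p(t - x\<^sub>i)\<close>.  Expanding these into alternating products of centered elements,
  each product is missing from at least one of them, which improves the trivial factor \<open>m + 1\<close> in
  the squared norm of their sum to \<open>m\<close>.
\<close>

context tracial_space
begin

section \<open>Elementary rules for the trace, the involution and the inner product\<close>

lemma tau_zero [simp]: "\<tau> 0 = 0"
  using tau_scale[of 0 0] by simp

lemma tau_minus: "\<tau> (- x) = - \<tau> x"
  using tau_scale[of "- 1" x] by simp

lemma tau_diff: "\<tau> (x - y) = \<tau> x - \<tau> y"
  using tau_add[of x "- y"] by (simp add: tau_minus)

lemma tau_sum: "\<tau> (sum f A) = (\<Sum>k\<in>A. \<tau> (f k))"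
  by (induction A rule: infinite_finite_induct) (simp_all add: tau_add)

lemma star_0 [simp]: "star 0 = 0"
  using star_scale[of 0 0] by simp

lemma star_1 [simp]: "star 1 = 1"
  using star_mult[of 1 "star 1"] by (simp add: star_star)

lemma star_sum: "star (sum f A) = (\<Sum>k\<in>A. star (f k))"
  by (induction A rule: infinite_finite_induct) (simp_all add: star_add)

lemma ip_zero_left [simp]: "ip 0 x = 0" and ip_zero_right [simp]: "ip x 0 = 0"
  by (simp_all add: ip_def)

lemma ip_sum_right: "ip y (sum f K) = (\<Sum>k\<in>K. ip y (f k))"
  by (simp add: ip_def sum_distrib_left tau_sum)

lemma norm2_sq: "(norm2 x)\<^sup>2 = Re (ip x x)"
  by (simp add: ip_self)

subsection \<open>Polynomials and their difference quotients\<close>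

text \<open>Horner recursion makes evaluation follow \<open>pCons\<close>, so that identities about
  it go by induction on the polynomial.\<close>

primrec horner :: "'a \<Rightarrow> complex list \<Rightarrow> 'a" where
  "horner z [] = 0"
| "horner z (c # cs) = scale c 1 + z * horner z cs"

definition pev :: "'a \<Rightarrow> complex poly \<Rightarrow> 'a" where
  "pev z p = horner z (coeffs p)"

lemma pev_0 [simp]: "pev z 0 = 0"
  by (simp add: pev_def)

lemma pev_pCons [simp]: "pev z (pCons c p) = scale c 1 + z * pev z p"
  by (cases "c = 0 \<and> p = 0") (auto simp: pev_def cCons_def)

lemma pev_1 [simp]: "pev z 1 = 1"
  by (simp add: one_pCons)

lemma pev_add: "pev z (p + q) = pev z p + pev z q"
  by (induction p q rule: poly_induct2) (simp_all add: scale_left_distrib algebra_simps)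

lemma pev_smult: "pev z (smult c p) = scale c (pev z p)"
  by (induction p) (simp_all add: scale_right_distrib scale_mult_right)

lemma pev_minus: "pev z (- p) = - pev z p"
  using pev_smult[of z "- 1" p] by simp

lemma pev_diff: "pev z (p - q) = pev z p - pev z q"
  using pev_add[of z p "- q"] by (simp add: pev_minus)

lemma pev_mult: "pev z (p * q) = pev z p * pev z q"
  by (induction p) (simp_all add: pev_add pev_smult algebra_simps scale_mult_left)

lemma pev_monom: "pev z (monom c r) = scale c (z ^ r)"
  by (induction r) (simp_all add: monom_0 monom_Suc scale_mult_right)

lemma pev_commute: "z * w = w * z \<Longrightarrow> pev z p * w = w * pev z p"
  by (induction p) (simp_all add: algebra_simps scale_mult_left scale_mult_right, metis mult.assoc)

lemma star_pev: "star z = z \<Longrightarrow> star (pev z p) = pev z (map_poly cnj p)"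
  by (induction p) (simp_all add: star_add star_scale star_mult map_poly_pCons pev_commute)

lemma pev_altdef: "pev z p = (\<Sum>k<Suc (degree p). scale (coeff p k) (z ^ k))"
proof -
  have "p = (\<Sum>k<Suc (degree p). monom (coeff p k) k)"
    using poly_as_sum_of_monoms[of p] by (simp add: lessThan_Suc_atMost)
  moreover have "pev z (sum f A) = (\<Sum>k\<in>A. pev z (f k))" for f and A :: "nat set"
    by (induction A rule: infinite_finite_induct) (simp_all add: pev_add)
  ultimately show ?thesis
    by (metis (no_types, lifting) pev_monom sum.cong)
qed

lemma pev_in_polynomials: "pev z p \<in> polynomials_in z"
  unfolding polynomials_in_def pev_altdef by blast

text \<open>\<open>dq z p a b\<close> is \<open>(\<tau> \<otimes> \<tau>) (a \<cdot> \<partial>p(z) \<cdot> b)\<close>, where \<open>\<partial>\<close> is the derivation with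
  \<open>\<partial>X = 1 \<otimes> 1\<close>; the recursion is \<open>\<partial>(c + X p) = 1 \<otimes> p + X \<cdot> \<partial>p\<close>.\<close>

primrec dq_list :: "'a \<Rightarrow> complex list \<Rightarrow> 'a \<Rightarrow> 'a \<Rightarrow> complex" where
  "dq_list z [] a b = 0"
| "dq_list z (c # cs) a b = \<tau> a * \<tau> (horner z cs * b) + dq_list z cs (a * z) b"

definition dq :: "'a \<Rightarrow> complex poly \<Rightarrow> 'a \<Rightarrow> 'a \<Rightarrow> complex" where
  "dq z p = dq_list z (coeffs p)"

lemma dq_0 [simp]: "dq z 0 a b = 0"
  by (simp add: dq_def)

lemma dq_pCons [simp]: "dq z (pCons c p) a b = \<tau> a * \<tau> (pev z p * b) + dq z p (a * z) b"
  by (cases "c = 0 \<and> p = 0") (auto simp: dq_def pev_def cCons_def)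

lemma dq_add: "dq z (p + q) a b = dq z p a b + dq z q a b"
  by (induction p q arbitrary: a rule: poly_induct2)
    (simp_all add: pev_add algebra_simps tau_add)

lemma dq_smult: "dq z (smult c p) a b = c * dq z p a b"
  by (induction p arbitrary: a) (simp_all add: pev_smult scale_mult_left tau_scale algebra_simps)

lemma dq_left_add: "dq z p (a + a') b = dq z p a b + dq z p a' b"
  by (induction p arbitrary: a a') (simp_all add: tau_add algebra_simps)

lemma dq_left_scale: "dq z p (scale c a) b = c * dq z p a b"
  by (induction p arbitrary: a) (simp_all add: tau_scale scale_mult_left algebra_simps)

lemma dq_right_add: "dq z p a (b + b') = dq z p a b + dq z p a b'"
  by (induction p arbitrary: a) (simp_all add: tau_add algebra_simps)

lemma dq_right_scale: "dq z p a (scale c b) = c * dq z p a b"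
  by (induction p arbitrary: a) (simp_all add: tau_scale scale_mult_right algebra_simps)

lemma dq_left_0 [simp]: "dq z p 0 b = 0"
  using dq_left_scale[of z p 0 0 b] by simp

text \<open>The Leibniz rule under \<tau> \<otimes> \<tau>: the factor that is not differentiated is
  absorbed by the outer argument on its side.\<close>

lemma dq_mult: "dq z (p * q) a b = dq z p a (pev z q * b) + dq z q (a * pev z p) b"
  by (induction p arbitrary: a)
    (simp_all add: dq_add dq_smult dq_left_add dq_left_scale pev_mult algebra_simps scale_mult_right)

lemma dq_monom: "dq z (monom 1 r) a b = (\<Sum>k<r. \<tau> (a * z ^ k) * \<tau> (z ^ (r - 1 - k) * b))"
proof (induction r arbitrary: a)
  case (Suc r)
  have "dq z (monom 1 (Suc r)) a b = \<tau> a * \<tau> (z ^ r * b)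
      + (\<Sum>k<r. \<tau> (a * z ^ Suc k) * \<tau> (z ^ (r - Suc k) * b))"
    by (simp add: monom_Suc pev_monom Suc mult.assoc)
  then show ?case
    by (simp add: sum.lessThan_Suc_shift del: sum.lessThan_Suc)
qed (simp add: monom_0)

lemma dq_altdef: "dq z p a b = (\<Sum>k<Suc (degree p). coeff p k * dq z (monom 1 k) a b)"
proof -
  have "p = (\<Sum>k<Suc (degree p). smult (coeff p k) (monom 1 k))"
    using poly_as_sum_of_monoms[of p] by (simp add: lessThan_Suc_atMost smult_monom)
  moreover have "dq z (sum f A) a b = (\<Sum>k\<in>A. dq z (f k) a b)" for f and A :: "nat set"
    by (induction A rule: infinite_finite_induct) (simp_all add: dq_add)
  ultimately show ?thesis
    by (metis (no_types, lifting) dq_smult sum.cong)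
qed

text \<open>Every left factor in the expansion of \<open>dq\<close> has the form
  \<open>\<tau> (a * z ^ k)\<close>. The hypothesis ranges over all polynomials because it has to
  pass from \<open>a\<close> to \<open>a * z\<close>.\<close>

lemma dq_eq_0_left: "(\<And>q. \<tau> (a * pev z q) = 0) \<Longrightarrow> dq z p a b = 0"
proof (induction p arbitrary: a)
  case (pCons c p)
  have "\<tau> (a * z * pev z q) = 0" for q
    using pCons.prems[of "pCons 0 q"] by (simp add: mult.assoc)
  then show ?case
    using pCons.IH pCons.prems[of 1] by simp
qed simp

lemma dq_eq_0_right: "(\<And>q. \<tau> (pev z q * b) = 0) \<Longrightarrow> dq z p a b = 0"
  by (induction p arbitrary: a) simp_all

abbreviation conj_functional :: "'a \<Rightarrow> complex poly \<Rightarrow> complex" where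
  "conj_functional z p \<equiv> dq z p 1 1"

lemma conj_functional_monom:
  "conj_functional z (monom 1 r) = (\<Sum>k<r. \<tau> (z ^ k) * \<tau> (z ^ (r - 1 - k)))"
  by (simp add: dq_monom)

text \<open>\<open>conj_functional z\<close> acts on formal polynomials, and the bound is what makes
  it descend to the elements \<open>pev z p\<close>. For self-adjoint \<open>z\<close> and
  \<open>C \<ge> 0\<close>, Riesz representation makes the bound equivalent to
  \<open>free_Fisher z \<le> C\<^sup>2\<close>.\<close>

definition conj_bounded :: "'a \<Rightarrow> real \<Rightarrow> bool" where
  "conj_bounded z C \<longleftrightarrow> (\<forall>p. cmod (conj_functional z p) \<le> C * norm2 (pev z p))"

lemma tau_pev_cnj: "star z = z \<Longrightarrow> \<tau> (pev z (map_poly cnj p)) = cnj (\<tau> (pev z p))"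
  by (metis star_pev tau_star)

text \<open>The moments of a self-adjoint element are real. The induction needs a power of
  \<open>z\<close> on the left, where the recursion of \<open>dq\<close> accumulates it.\<close>

lemma conj_functional_cnj:
  assumes z: "star z = z"
  shows "conj_functional z (map_poly cnj p) = cnj (conj_functional z p)"
proof -
  have "dq z (map_poly cnj p) (z ^ k) 1 = cnj (dq z p (z ^ k) 1)" for k
  proof (induction p arbitrary: k)
    case (pCons c p)
    have "cnj (\<tau> (z ^ k)) = \<tau> (z ^ k)"
      using tau_pev_cnj[OF z, of "monom 1 k"] by (simp add: pev_monom map_poly_monom)
    then show ?case
      using pCons.IH[of "Suc k"]
      by (simp add: map_poly_pCons tau_pev_cnj z power_commutes)
  qed simp
  from this[of 0] show ?thesis by simp
qed

lemma pev_scale: "pev (scale c z) p = pev z (pcompose p [:0, c:])"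
  by (induction p)
    (simp_all add: pcompose_pCons pev_add pev_smult scale_mult_left scale_mult_right)

text \<open>The chain rule for the substitution of \<open>c X\<close> for the variable.\<close>

lemma dq_scale: "c * dq (scale c z) p a b = dq z (pcompose p [:0, c:]) a b"
  by (induction p arbitrary: a)
    (simp_all add: pcompose_pCons pev_smult pev_scale scale_mult_left scale_mult_right
      tau_scale dq_add dq_smult dq_left_scale algebra_simps)

text \<open>Passing from \<open>p\<close> at \<open>c z\<close> to \<open>p (c X)\<close> at
  \<open>z\<close> keeps the value and multiplies the functional by \<open>c\<close>: conjugate
  variables are homogeneous of degree -1.\<close>

lemma conj_bounded_scale_iff:
  assumes "0 < c"
  shows "conj_bounded (scale (of_real c) z) C \<longleftrightarrow> conj_bounded z (c * C)"
proof
  let ?c = "complex_of_real c"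
  have c: "?c * inverse ?c = 1"
    using assms by simp
  have eq: "c * cmod (conj_functional (scale ?c z) p) = cmod (conj_functional z (pcompose p [:0, ?c:]))" for p
    using dq_scale[of ?c z p 1 1, THEN arg_cong[where f = cmod]] assms by (simp add: norm_mult)
  have inv: "pcompose (pcompose p [:0, inverse ?c:]) [:0, ?c:] = p" for p
    using c by (simp add: pcompose_assoc[symmetric] pcompose_pCons mult.commute[of "inverse ?c"])
  {
    assume *: "conj_bounded (scale ?c z) C"
    show "conj_bounded z (c * C)"
      unfolding conj_bounded_def
    proof
      fix p
      define q where "q = pcompose p [:0, inverse ?c:]"
      have "c * cmod (conj_functional (scale ?c z) q) \<le> c * (C * norm2 (pev (scale ?c z) q))"
        using * assms unfolding conj_bounded_def by (intro mult_left_mono) auto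
      then show "cmod (conj_functional z p) \<le> c * C * norm2 (pev z p)"
        by (simp add: eq pev_scale q_def inv mult.assoc)
    qed
  next
    assume *: "conj_bounded z (c * C)"
    show "conj_bounded (scale ?c z) C"
      unfolding conj_bounded_def
    proof
      fix p
      have "c * cmod (conj_functional (scale ?c z) p) \<le> c * C * norm2 (pev (scale ?c z) p)"
        using * unfolding conj_bounded_def eq pev_scale by blast
      then show "cmod (conj_functional (scale ?c z) p) \<le> C * norm2 (pev (scale ?c z) p)"
        using assms by (simp add: mult.assoc)
    qed
  }
qed

subsection \<open>Fisher information and boundedness of the conjugate functional\<close>

text \<open>The conjugate variable is built from a minimising sequence of
  \<open>\<parallel>p\<parallel>\<^sup>2 - 2 Re \<phi>(p)\<close> over the polynomials in \<open>z\<close>, \<open>\<phi>\<close> being the conjugate functional.\<close>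

lemma conj_bounded_imp_sequence:
  assumes bd: "conj_bounded z C" and C: "0 \<le> C"
  obtains P L where "(\<lambda>k. pev z (P k)) \<in> cauchy2"
    and "\<forall>q. (\<lambda>k. ip (pev z q) (pev z (P k))) \<longlonglongrightarrow> cnj (conj_functional z q)"
    and "(\<lambda>k. norm2 (pev z (P k))) \<longlonglongrightarrow> L" and "L \<le> C"
proof -
  define J where "J p = (norm2 (pev z p))\<^sup>2 - 2 * Re (conj_functional z p)" for p
  \<comment> \<open>Complete the square in \<open>norm2 (pev z p)\<close>.\<close>
  have low: "- C\<^sup>2 \<le> J p" for p
  proof -
    have "Re (conj_functional z p) \<le> C * norm2 (pev z p)"
      using bd complex_Re_le_cmod[of "conj_functional z p"] unfolding conj_bounded_def
      by (meson order_trans)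
    moreover have "0 \<le> (norm2 (pev z p) - C)\<^sup>2" by simp
    ultimately show ?thesis unfolding J_def by (simp add: power2_diff algebra_simps)
  qed
  define I where "I = Inf (range J)"
  have bdd: "bdd_below (range J)"
    using low by (auto intro!: bdd_belowI)
  have I: "I \<le> J p" for p
    unfolding I_def by (rule cInf_lower[OF _ bdd]) simp
  have "\<exists>p. J p < I + 1 / real (Suc k)" for k
    using cInf_lessD[of "range J" "I + 1 / real (Suc k)"] unfolding I_def by auto
  then obtain P where P: "\<And>k. J (P k) < I + 1 / real (Suc k)"
    by metis
  define X where "X k = pev z (P k)" for k
  have gap: "(norm2 (X m - X n))\<^sup>2 \<le> 2 / real (Suc m) + 2 / real (Suc n)" for m n
  proof -
    \<comment> \<open>The parallelogram identity at the midpoint \<open>h\<close>; the linear part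
      of \<open>J\<close> cancels.\<close>
    define h where "h = smult (1 / 2) (P m + P n)"
    have "(norm2 (X m - X n))\<^sup>2 = 2 * J (P m) + 2 * J (P n) - 4 * J h"
      unfolding J_def h_def norm2_sq
      by (simp add: X_def pev_smult pev_add dq_smult dq_add ip_scale_left ip_scale_right
          ip_add_left ip_add_right ip_diff_left ip_diff_right algebra_simps)
    then show ?thesis
      using P[of m] P[of n] I[of h] by simp
  qed
  have cau: "X \<in> cauchy2"
    unfolding cauchy2_def
  proof clarify
    fix e :: real assume e: "0 < e"
    then obtain N where N: "4 / e\<^sup>2 < real N"
      using reals_Archimedean2 by blast
    have "norm2 (X m - X n) < e" if "m \<ge> N" "n \<ge> N" for m n
    proof (rule power2_less_imp_less)
      have small: "2 / real (Suc j) < e\<^sup>2 / 2" if "j \<ge> N" for j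
      proof -
        have "4 / e\<^sup>2 < real (Suc j)" using N that by linarith
        then show ?thesis using e by (simp add: field_simps)
      qed
      show "(norm2 (X m - X n))\<^sup>2 < e\<^sup>2"
        using gap[of m n] small[OF that(1)] small[OF that(2)] by linarith
    qed (use e in simp)
    then show "\<exists>N. \<forall>m\<ge>N. \<forall>n\<ge>N. norm2 (X m - X n) < e" by blast
  qed
  have re: "(\<lambda>k. Re (ip (pev z q) (X k))) \<longlonglongrightarrow> Re (conj_functional z q)" for q
  proof -
    define R where "R k = Re (ip (pev z q) (X k)) - Re (conj_functional z q)" for k
    define N where "N = (norm2 (pev z q))\<^sup>2 + 1"
    have N: "0 < N" by (simp add: N_def add_nonneg_pos)
    have "(R k)\<^sup>2 \<le> N * (1 / real (Suc k))" for k
    proof -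
      \<comment> \<open>This \<open>t\<close> minimises \<open>t\<^sup>2 * N + 2 * t * R k\<close>.
        As \<open>J\<close> cannot fall below \<open>I\<close>, the gain
        \<open>(R k)\<^sup>2 / N\<close> is at most the excess of \<open>J (P k)\<close> over
        \<open>I\<close>. The summand 1 in \<open>N\<close> keeps it positive when
        \<open>pev z q = 0\<close>.\<close>
      define t where "t = - R k / N"
      have sym: "Re (ip (X k) (pev z q)) = Re (ip (pev z q) (X k))"
        by (subst ip_commute) simp
      have "J (P k + smult (of_real t) q) = J (P k) + t\<^sup>2 * (N - 1) + 2 * t * R k"
        unfolding J_def R_def N_def norm2_sq
        by (simp add: X_def[symmetric] pev_smult pev_add dq_smult dq_add ip_scale_left
            ip_scale_right ip_add_left ip_add_right sym power2_eq_square algebra_simps)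
      moreover have "t\<^sup>2 * (N - 1) + 2 * t * R k \<le> t\<^sup>2 * N + 2 * t * R k"
        by (simp add: algebra_simps)
      moreover have "t\<^sup>2 * N + 2 * t * R k = - ((R k)\<^sup>2 / N)"
        using N by (simp add: t_def field_simps power2_eq_square)
      ultimately have "(R k)\<^sup>2 / N \<le> 1 / real (Suc k)"
        using I[of "P k + smult (of_real t) q"] P[of k] by linarith
      then show ?thesis
        using N by (simp add: field_simps)
    qed
    moreover have "(\<lambda>k. N * (1 / real (Suc k))) \<longlonglongrightarrow> N * 0"
      by (intro tendsto_intros LIMSEQ_Suc[OF lim_1_over_n])
    ultimately have "(\<lambda>k. (R k)\<^sup>2) \<longlonglongrightarrow> 0"
      by (intro Lim_null_comparison[of "\<lambda>k. (R k)\<^sup>2" "\<lambda>k. N * (1 / real (Suc k))"])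
        (auto simp: always_eventually)
    then have "R \<longlonglongrightarrow> 0"
      by simp
    then show ?thesis
      unfolding R_def by (simp add: LIM_zero_iff)
  qed
  have pair: "(\<lambda>k. ip (pev z q) (X k)) \<longlonglongrightarrow> cnj (conj_functional z q)" for q
  proof -
    \<comment> \<open>Multiplying \<open>q\<close> by \<i> exchanges real and imaginary parts; the
      sign arises because \<open>ip\<close> is conjugate-linear on the left while the functional is
      linear.\<close>
    have "(\<lambda>k. Im (ip (pev z q) (X k))) \<longlonglongrightarrow> - Im (conj_functional z q)"
      using re[of "smult \<i> q"] by (simp add: pev_smult dq_smult ip_scale_left)
    with re[of q] show ?thesis
      by (simp add: tendsto_complex_iff)
  qed
  obtain L where L: "(\<lambda>k. norm2 (X k)) \<longlonglongrightarrow> L"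
    using cauchy2_norm2_convergent[OF cau] by (auto simp: convergent_def)
  have "L \<le> C + e" if e: "0 < e" for e
  proof -
    obtain N where N: "\<forall>m\<ge>N. \<forall>n\<ge>N. norm2 (X m - X n) < e"
      using cau e unfolding cauchy2_def by blast
    have "norm2 (X j) \<le> C + e" if j: "j \<ge> N" for j
    proof -
      \<comment> \<open>Pair \<open>X j\<close> with the later terms: as \<open>k\<close> grows, the
        pairing tends to the conjugate of the functional at \<open>P j\<close>, which is at most
        \<open>C * norm2 (X j)\<close>. Dividing by \<open>norm2 (X j)\<close> gives the
        bound.\<close>
      have "norm2 (X j) * norm2 (X j) \<le> cmod (ip (X j) (X k)) + norm2 (X j) * e"
        if k: "k \<ge> N" for k
      proof -
        have "norm2 (X j) * norm2 (X j) = cmod (ip (X j) (X k) + ip (X j) (X j - X k))"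
          by (simp add: ip_diff_right ip_self norm_mult power2_eq_square norm2_nonneg)
        also have "\<dots> \<le> cmod (ip (X j) (X k)) + norm2 (X j) * norm2 (X j - X k)"
          using norm_triangle_ineq Cauchy_Schwarz2 add_left_mono order_trans by meson
        also have "norm2 (X j) * norm2 (X j - X k) \<le> norm2 (X j) * e"
          using N j k by (intro mult_left_mono norm2_nonneg) (auto simp: less_imp_le)
        finally show ?thesis by simp
      qed
      moreover have "(\<lambda>k. cmod (ip (X j) (X k)) + norm2 (X j) * e)
          \<longlonglongrightarrow> cmod (cnj (conj_functional z (P j))) + norm2 (X j) * e"
        using pair[of "P j"] unfolding X_def by (intro tendsto_intros)
      ultimately have "norm2 (X j) * norm2 (X j) \<le> cmod (cnj (conj_functional z (P j))) + norm2 (X j) * e"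
        by (intro LIMSEQ_le_const) auto
      also have "\<dots> \<le> C * norm2 (X j) + norm2 (X j) * e"
        using bd by (simp add: conj_bounded_def X_def)
      also have "\<dots> = (C + e) * norm2 (X j)"
        by (simp add: algebra_simps)
      finally show ?thesis
        using norm2_nonneg[of "X j"] C e by (cases "norm2 (X j) = 0") auto
    qed
    then show ?thesis
      by (intro LIMSEQ_le_const2[OF L]) blast
  qed
  then have "L \<le> C"
    by (rule field_le_epsilon)
  with cau pair L show thesis
    unfolding X_def by (intro that[of P L] allI)
qed

lemma free_Fisher_eq:
  assumes "is_conjugate_variable z \<xi>"
  shows "free_Fisher z = ennreal ((L2_norm \<xi>)\<^sup>2)"
proof -
  have "(THE \<xi>. is_conjugate_variable z \<xi>) = \<xi>"
    using assms conjugate_variable_unique by (intro the_equality) auto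
  then show ?thesis
    using assms by (auto simp: free_Fisher_def)
qed

lemma conj_bounded_imp_free_Fisher_le:
  assumes z: "star z = z" and bd: "conj_bounded z C" and C: "0 \<le> C"
  shows "free_Fisher z \<le> ennreal (C\<^sup>2)"
proof -
  obtain P L where cau: "(\<lambda>k. pev z (P k)) \<in> cauchy2"
    and pair: "\<forall>q. (\<lambda>k. ip (pev z q) (pev z (P k))) \<longlonglongrightarrow> cnj (conj_functional z q)"
    and L: "(\<lambda>k. norm2 (pev z (P k))) \<longlonglongrightarrow> L" "L \<le> C"
    by (rule conj_bounded_imp_sequence[OF bd C])
  define \<xi> where "\<xi> = L2_class (\<lambda>k. pev z (P k))"
  have "\<xi> \<in> L2_of z"
    unfolding L2_of_def L2_closure_def
  proof (intro CollectI conjI allI impI)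
    show "\<xi> \<in> L2"
      unfolding \<xi>_def by (rule L2_class_in[OF cau])
    fix e :: real assume "0 < e"
    then obtain k where "L2_dist \<xi> (L2_embed (pev z (P k))) < e"
      using order_tendstoD(2)[OF L2_dist_terms[OF cau], of e]
      unfolding \<xi>_def by (auto simp: eventually_sequentially)
    then show "\<exists>\<eta>\<in>L2_embed ` polynomials_in z. L2_dist \<xi> \<eta> < e"
      using pev_in_polynomials by blast
  qed
  moreover have "L2_inner (L2_embed (z ^ r)) \<xi> = (\<Sum>k<r. \<tau> (z ^ k) * \<tau> (z ^ (r - 1 - k)))" for r
  proof -
    have "(\<lambda>k. ip (z ^ r) (pev z (P k))) \<longlonglongrightarrow> L2_inner (L2_embed (z ^ r)) \<xi>"
      unfolding \<xi>_def L2_embed_def by (rule L2_inner_class[OF cauchy2_const cau])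
    moreover have "(\<lambda>k. ip (z ^ r) (pev z (P k))) \<longlonglongrightarrow> cnj (conj_functional z (monom 1 r))"
      using pair[rule_format, of "monom 1 r"] by (simp add: pev_monom)
    ultimately have "L2_inner (L2_embed (z ^ r)) \<xi> = cnj (conj_functional z (monom 1 r))"
      by (rule LIMSEQ_unique)
    \<comment> \<open>The limit is the conjugate of the functional, but on monomials the functional
      is real.\<close>
    also have "\<dots> = conj_functional z (monom 1 r)"
      using conj_functional_cnj[OF z, of "monom 1 r"] by (simp add: map_poly_monom)
    finally show ?thesis
      by (simp add: conj_functional_monom)
  qed
  ultimately have "is_conjugate_variable z \<xi>"
    unfolding is_conjugate_variable_def by blast
  moreover have "L2_norm \<xi> = L"
    unfolding \<xi>_def by (rule LIMSEQ_unique[OF L2_norm_class[OF cau] L(1)])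
  moreover have "0 \<le> L"
    by (rule LIMSEQ_le_const[OF L(1)]) (simp add: norm2_nonneg)
  ultimately show ?thesis
    using L(2) by (simp add: free_Fisher_eq power_mono ennreal_leI)
qed

text \<open>A finite value of \<open>free_Fisher\<close> means that a conjugate variable exists;
  Cauchy-Schwarz along a sequence representing it bounds the functional.\<close>

lemma free_Fisher_le_imp_conj_bounded:
  assumes z: "star z = z" and le: "free_Fisher z \<le> ennreal (C\<^sup>2)" and C: "0 \<le> C"
  shows "conj_bounded z C"
proof -
  have "\<exists>\<xi>. is_conjugate_variable z \<xi>"
  proof (rule ccontr)
    assume "\<not> ?thesis"
    with le show False
      by (simp add: free_Fisher_def top_unique)
  qed
  then obtain \<xi> where \<xi>: "is_conjugate_variable z \<xi>" ..
  then obtain X where X: "X \<in> cauchy2" "\<xi> = L2_class X"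
    using L2_cases[of \<xi>] unfolding is_conjugate_variable_def L2_of_def L2_closure_def by blast
  have lim: "(\<lambda>n. norm2 (X n)) \<longlonglongrightarrow> L2_norm \<xi>"
    using L2_norm_class[OF X(1)] X(2) by simp
  have "(L2_norm \<xi>)\<^sup>2 \<le> C\<^sup>2"
    using le by (simp add: free_Fisher_eq[OF \<xi>] ennreal_le_iff)
  then have L: "L2_norm \<xi> \<le> C"
    using C by (rule power2_le_imp_le)
  have pow: "(\<lambda>n. ip (z ^ r) (X n)) \<longlonglongrightarrow> cnj (conj_functional z (monom 1 r))" for r
  proof -
    have "(\<lambda>n. ip (z ^ r) (X n)) \<longlonglongrightarrow> L2_inner (L2_embed (z ^ r)) \<xi>"
      unfolding X(2) L2_embed_def by (rule L2_inner_class[OF cauchy2_const X(1)])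
    moreover have "L2_inner (L2_embed (z ^ r)) \<xi> = conj_functional z (monom 1 r)"
      using \<xi> unfolding is_conjugate_variable_def conj_functional_monom by blast
    ultimately show ?thesis
      using conj_functional_cnj[OF z, of "monom 1 r"] by (simp add: map_poly_monom)
  qed
  show ?thesis
    unfolding conj_bounded_def
  proof
    fix q
    have "(\<lambda>n. ip (pev z q) (X n)) \<longlonglongrightarrow> cnj (conj_functional z q)"
      unfolding pev_altdef dq_altdef[of z q] ip_sum_left ip_scale_left cnj_sum complex_cnj_mult
      by (intro tendsto_intros pow)
    then have "cmod (cnj (conj_functional z q)) \<le> norm2 (pev z q) * L2_norm \<xi>"
      by (intro LIMSEQ_le[OF tendsto_norm tendsto_mult[OF tendsto_const lim]])
        (auto intro: Cauchy_Schwarz2)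
    also have "\<dots> \<le> norm2 (pev z q) * C"
      by (rule mult_left_mono[OF L norm2_nonneg])
    finally show "cmod (conj_functional z q) \<le> C * norm2 (pev z q)"
      by (simp add: mult.commute)
  qed
qed

subsection \<open>Words in free variables\<close>

definition ev :: "('i \<Rightarrow> 'a) \<Rightarrow> ('i \<times> complex poly) list \<Rightarrow> 'a" where
  "ev y ws = prod_list (map (\<lambda>(i, p). pev (y i) p) ws)"

lemma ev_simps [simp]:
  "ev y [] = 1" "ev y ((i, p) # ws) = pev (y i) p * ev y ws" "ev y (ws @ vs) = ev y ws * ev y vs"
  by (simp_all add: ev_def)

text \<open>Alternating words of centered letters, the words whose trace freeness annihilates unless
  they are empty.\<close>

definition reduced :: "('i \<Rightarrow> 'a) \<Rightarrow> ('i \<times> complex poly) list \<Rightarrow> bool" where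
  "reduced y ws \<longleftrightarrow> (\<forall>(i, p)\<in>set ws. \<tau> (pev (y i) p) = 0) \<and> distinct_adj (map fst ws)"

lemma reduced_Nil [simp]: "reduced y []"
  by (simp add: reduced_def)

lemma reduced_Cons:
  "reduced y ((i, p) # ws) \<longleftrightarrow>
     \<tau> (pev (y i) p) = 0 \<and> reduced y ws \<and> (ws \<noteq> [] \<longrightarrow> i \<noteq> fst (hd ws))"
  by (cases ws) (auto simp: reduced_def)

lemma reduced_append:
  "reduced y (ws @ vs) \<longleftrightarrow>
     reduced y ws \<and> reduced y vs \<and> (ws \<noteq> [] \<longrightarrow> vs \<noteq> [] \<longrightarrow> fst (last ws) \<noteq> fst (hd vs))"
  by (auto simp: reduced_def distinct_adj_append_iff last_map hd_map)

lemma not_distinct_adj_decomp: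
  assumes "\<not> distinct_adj (map f ws)"
  obtains u a b v where "ws = u @ a # b # v" "f a = f b"
proof -
  have "\<exists>u a b v. ws = u @ a # b # v \<and> f a = f b"
    using assms
  proof (induction ws)
    case (Cons a ws)
    show ?case
    proof (cases "distinct_adj (map f ws)")
      case True
      with Cons.prems obtain b v where "ws = b # v" "f a = f b"
        by (cases ws) auto
      then show ?thesis by (metis append_Nil)
    next
      case False
      with Cons.IH show ?thesis by (metis append_Cons)
    qed
  qed simp
  with that show thesis by blast
qed

text \<open>Words are reduced by merging neighbours with the same index and by splitting off
  expectations; either step leaves only shorter or more centered words.\<close>

lemma reduced_word_induct [case_names merge split reduced]:
  assumes merge: "\<And>u v i p q. P (u @ (i, p * q) # v) \<Longrightarrow> P (u @ (i, p) # (i, q) # v)"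
    and split: "\<And>u v i p c. P (u @ (i, p - [:c:]) # v) \<Longrightarrow> P (u @ v) \<Longrightarrow> P (u @ (i, p) # v)"
    and red: "\<And>ws. reduced y ws \<Longrightarrow> P ws"
  shows "P ws"
proof (induction ws rule: length_induct)
  case (1 ws)
  show ?case
  proof (cases "distinct_adj (map fst ws)")
    case False
    then obtain u a b v where ws: "ws = u @ a # b # v" "fst a = fst b"
      by (rule not_distinct_adj_decomp)
    obtain i p q where "a = (i, p)" "b = (i, q)"
      using ws(2) by (metis prod.collapse)
    then show ?thesis
      using ws 1 merge by simp
  next
    case True
    \<comment> \<open>The letters of \<open>u\<close> are already centered. Centering the next
      letter keeps the length, and deleting it gives a shorter word, covered by the outer induction
      even if equal indices become neighbours.\<close>
    have "P (u @ v)" if "length (u @ v) = length ws" "distinct_adj (map fst (u @ v))"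
      "\<forall>(i, p)\<in>set u. \<tau> (pev (y i) p) = 0" for u v
      using that
    proof (induction v arbitrary: u)
      case Nil
      then show ?case by (intro red) (simp add: reduced_def)
    next
      case (Cons a v)
      obtain i p where a: "a = (i, p)" by (cases a)
      define c where "c = \<tau> (pev (y i) p)"
      have "P ((u @ [(i, p - [:c:])]) @ v)"
        using Cons.prems by (intro Cons.IH) (auto simp: a pev_diff tau_diff tau_scale tau_one c_def)
      moreover have "P (u @ v)"
        using 1 Cons.prems(1) by simp
      ultimately show ?case
        using split by (simp add: a)
    qed
    from this[of "[]" ws] True show ?thesis by simp
  qed
qed

text \<open>Freeness tested on polynomials in the variables rather than on the star-algebras they
  generate; in this form it passes to permuted families and to partial sums.\<close>

definition poly_free :: "'i set \<Rightarrow> ('i \<Rightarrow> 'a) \<Rightarrow> bool" where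
  "poly_free I y \<longleftrightarrow>
     (\<forall>ws. reduced y ws \<longrightarrow> ws \<noteq> [] \<longrightarrow> fst ` set ws \<subseteq> I \<longrightarrow> \<tau> (ev y ws) = 0)"

lemma poly_freeD:
  "poly_free I y \<Longrightarrow> reduced y ws \<Longrightarrow> ws \<noteq> [] \<Longrightarrow> fst ` set ws \<subseteq> I \<Longrightarrow> \<tau> (ev y ws) = 0"
  by (simp add: poly_free_def)

section \<open>Orthogonality of reduced words\<close>

definition adj :: "('i \<times> complex poly) list \<Rightarrow> ('i \<times> complex poly) list" where
  "adj ws = rev (map (\<lambda>(i, p). (i, map_poly cnj p)) ws)"

lemma adj_simps [simp]: "adj [] = []" "adj ((i, p) # ws) = adj ws @ [(i, map_poly cnj p)]"
  by (simp_all add: adj_def)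

lemma fst_set_adj [simp]: "fst ` set (adj ws) = fst ` set ws"
  by (force simp: adj_def image_iff)

lemma map_fst_adj: "map fst (adj ws) = rev (map fst ws)"
  by (simp add: adj_def rev_map split_def)

lemma star_ev:
  "(\<And>i. i \<in> fst ` set ws \<Longrightarrow> star (y i) = y i) \<Longrightarrow> star (ev y ws) = ev y (adj ws)"
  by (induction ws) (auto simp: star_mult star_pev)

lemma reduced_adj:
  assumes "\<And>i. i \<in> fst ` set ws \<Longrightarrow> star (y i) = y i" and "reduced y ws"
  shows "reduced y (adj ws)"
proof -
  have "distinct_adj (map fst (adj ws))"
    using assms(2) by (simp add: map_fst_adj reduced_def)
  moreover have "\<forall>(i, p)\<in>set (adj ws). \<tau> (pev (y i) p) = 0"
    using assms by (force simp: adj_def reduced_def tau_pev_cnj)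
  ultimately show ?thesis
    by (simp add: reduced_def)
qed

text \<open>If the first letters have different indices, the adjoint of one word followed by the
  other is reduced and has trace zero. If the indices agree, the two letters merge: the centered
  part of their product again gives a reduced word, and its expectation leaves the shorter words to
  the induction.\<close>

lemma ip_reduced_words:
  assumes free: "poly_free I y" and self: "\<And>i. i \<in> I \<Longrightarrow> star (y i) = y i"
    and "reduced y ws" "reduced y vs" "fst ` set ws \<subseteq> I" "fst ` set vs \<subseteq> I"
    and "map fst ws \<noteq> map fst vs"
  shows "ip (ev y ws) (ev y vs) = 0"
  using assms(3-)
proof (induction ws arbitrary: vs)
  case Nil
  then show ?case
    by (auto simp: ip_def intro: poly_freeD[OF free])
next
  case (Cons a ws)
  obtain i p where a: "a = (i, p)" by (cases a)
  have self': "star (y j) = y j" if "j \<in> fst ` set (a # ws)" for j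
    using Cons.prems(3) that by (intro self) blast
  have radj: "reduced y (adj (a # ws))"
    by (rule reduced_adj[OF self' Cons.prems(1)])
  have adjI: "fst ` set (adj (a # ws)) \<subseteq> I"
    using Cons.prems(3) by simp
  show ?case
  proof (cases vs)
    case Nil
    have "\<tau> (ev y (adj (a # ws))) = 0"
      by (rule poly_freeD[OF free radj _ adjI]) (simp add: a)
    then show ?thesis
      using star_ev[of "a # ws" y, OF self'] by (simp add: Nil ip_def)
  next
    case (Cons b vs')
    obtain j q where b: "b = (j, q)" by (cases b)
    show ?thesis
    proof (cases "i = j")
      case False
      have "reduced y (adj (a # ws) @ vs)"
        using radj Cons.prems(2) False by (simp add: reduced_append reduced_Cons Cons a b)
      then have "\<tau> (ev y (adj (a # ws) @ vs)) = 0"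
        by (rule poly_freeD[OF free]) (use adjI Cons.prems(4) in \<open>simp_all add: image_Un a\<close>)
      then show ?thesis
        using star_ev[of "a # ws" y, OF self'] by (simp add: ip_def)
    next
      case True
      define r where "r = map_poly cnj p * q"
      define c where "c = \<tau> (pev (y i) r)"
      let ?w = "adj ws @ (i, r - [:c:]) # vs'"
      have red: "reduced y ws" "reduced y vs'"
        using Cons.prems(1,2) by (auto simp: a b Cons reduced_Cons)
      have "reduced y ?w"
        using radj Cons.prems(2) True
        by (auto simp: a b Cons reduced_append reduced_Cons pev_diff tau_diff tau_scale tau_one c_def)
      then have "\<tau> (ev y ?w) = 0"
        by (rule poly_freeD[OF free]) (use adjI Cons.prems(4) in \<open>simp_all add: image_Un a b Cons\<close>)
      moreover have "ip (ev y ws) (ev y vs') = 0"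
        using red Cons.prems by (intro Cons.IH) (auto simp: a b Cons True)
      moreover have "star (ev y ws) = ev y (adj ws)" "star (pev (y i) p) = pev (y i) (map_poly cnj p)"
        using star_ev[of ws y] self' star_pev[of "y i" p] by (auto simp: a)
      ultimately show ?thesis
        by (simp add: a b Cons True[symmetric] ip_def star_mult r_def pev_mult pev_diff
            left_diff_distrib right_diff_distrib mult.assoc scale_mult_left scale_mult_right
            tau_diff tau_scale)
    qed
  qed
qed

section \<open>Spans of reduced words and their decomposition by index pattern\<close>

lemma bilinear_span:
  assumes "a \<in> span A" "b \<in> span B"
    and "\<And>a b. a \<in> A \<Longrightarrow> b \<in> B \<Longrightarrow> a * b \<in> span C"
  shows "a * b \<in> span C"
  using assms(1)
proof (induction rule: span_induct_alt)
  case (step c x z)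
  have "x * b \<in> span C"
    using assms(2)
    by (induction rule: span_induct_alt)
      (auto simp: distrib_left scale_mult_right intro!: span_add span_scale span_zero assms(3) step)
  with step show ?case
    by (auto simp: distrib_right scale_mult_left intro!: span_add span_scale)
qed (simp add: span_zero)

lemma ip_span_eq_0:
  assumes "a \<in> span A" "b \<in> span B" and "\<And>a b. a \<in> A \<Longrightarrow> b \<in> B \<Longrightarrow> ip a b = 0"
  shows "ip a b = 0"
  using assms(1)
proof (induction rule: span_induct_alt)
  case (step c x z)
  have "ip x b = 0"
    using assms(2)
    by (induction rule: span_induct_alt) (auto simp: ip_add_right ip_scale_right assms(3) step)
  with step show ?case
    by (simp add: ip_add_left ip_scale_left)
qed simp

definition reduced_words :: "('i \<Rightarrow> 'a) \<Rightarrow> 'i set \<Rightarrow> 'a set" where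
  "reduced_words y S = {ev y ws | ws. reduced y ws \<and> fst ` set ws \<subseteq> S}"

lemma ev_in_span_reduced_words:
  "fst ` set ws \<subseteq> S \<Longrightarrow> ev y ws \<in> span (reduced_words y S)"
proof (induction ws rule: reduced_word_induct[where y = y])
  case (merge u v i p q)
  then show ?case by (simp add: pev_mult mult.assoc)
next
  case (split u v i p c)
  have "ev y (u @ (i, p - [:c:]) # v) + scale c (ev y (u @ v)) \<in> span (reduced_words y S)"
    using split by (intro span_add span_scale) auto
  then show ?case
    by (simp add: pev_diff algebra_simps scale_mult_left scale_mult_right)
next
  case (reduced ws)
  then show ?case
    unfolding reduced_words_def by (intro span_base) blast
qed

lemma pev_sum_in_span_reduced_words:
  assumes "finite S"
  shows "pev (\<Sum>i\<in>S. y i) p \<in> span (reduced_words y S)"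
proof -
  \<comment> \<open>The prefix \<open>u\<close> takes up one letter from each factor of the sum as
    the Horner form is expanded.\<close>
  have "ev y u * pev (\<Sum>i\<in>S. y i) p \<in> span (reduced_words y S)" if "fst ` set u \<subseteq> S" for u
    using that
  proof (induction p arbitrary: u)
    case (pCons c p)
    have "ev y (u @ [(i, [:0, 1:])]) * pev (\<Sum>i\<in>S. y i) p \<in> span (reduced_words y S)" if "i \<in> S" for i
      using pCons.prems that by (intro pCons.IH) auto
    then have "scale c (ev y u) + (\<Sum>i\<in>S. ev y (u @ [(i, [:0, 1:])]) * pev (\<Sum>i\<in>S. y i) p)
        \<in> span (reduced_words y S)"
      using pCons.prems by (intro span_add span_scale span_sum ev_in_span_reduced_words)
    then show ?case
      by (simp add: distrib_left scale_mult_right sum_distrib_left sum_distrib_right mult.assoc)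
  qed (simp add: span_zero)
  from this[of "[]"] show ?thesis by simp
qed

text \<open>The summand of the free product decomposition that belongs to the index pattern
  \<open>w\<close>; different patterns give orthogonal subspaces.\<close>

definition component :: "('i \<Rightarrow> 'a) \<Rightarrow> 'i list \<Rightarrow> 'a set" where
  "component y w = span {ev y ws | ws. reduced y ws \<and> map fst ws = w}"

lemma ip_component:
  assumes "poly_free I y" "\<And>i. i \<in> I \<Longrightarrow> star (y i) = y i"
    and "a \<in> component y w" "b \<in> component y v" "w \<noteq> v" "set w \<subseteq> I" "set v \<subseteq> I"
  shows "ip a b = 0"
  using assms(3,4) unfolding component_def
proof (rule ip_span_eq_0)
  fix a b
  assume "a \<in> {ev y ws |ws. reduced y ws \<and> map fst ws = w}"
    "b \<in> {ev y ws |ws. reduced y ws \<and> map fst ws = v}"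
  then obtain ws vs where "a = ev y ws" "b = ev y vs" "reduced y ws" "reduced y vs"
    "map fst ws = w" "map fst vs = v" by blast
  then show "ip a b = 0"
    using ip_reduced_words[OF assms(1,2), of ws vs] assms(5-7) by (metis list.set_map)
qed

text \<open>The family \<open>f\<close> is total and vanishes off \<open>F\<close>, so that the
  decompositions of several vectors can be added over one common set of patterns.\<close>

lemma span_reduced_words_decomp:
  assumes "u \<in> span (reduced_words y S)"
  shows "\<exists>f F. finite F \<and> F \<subseteq> lists S \<and> (\<forall>w. f w \<in> component y w) \<and>
    (\<forall>w. w \<notin> F \<longrightarrow> f w = 0) \<and> u = sum f F"
  using assms
proof (induction rule: span_induct_alt)
  case base
  show ?case
    by (rule exI[of _ "\<lambda>_. 0"], rule exI[of _ "{}"]) (simp add: component_def span_zero)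
next
  case (step c x z)
  from step.IH obtain f F where f: "finite F" "F \<subseteq> lists S" "\<And>w. f w \<in> component y w"
    "\<And>w. w \<notin> F \<Longrightarrow> f w = 0" "z = sum f F" by blast
  from step.hyps(1) obtain ws where ws: "x = ev y ws" "reduced y ws" "fst ` set ws \<subseteq> S"
    by (auto simp: reduced_words_def)
  define w where "w = map fst ws"
  define g where "g = f(w := scale c x + f w)"
  have x: "x \<in> component y w"
    unfolding component_def w_def ws(1) using ws(2) by (intro span_base) blast
  have "g v \<in> component y v" for v
    using f(3) x unfolding g_def component_def by (auto intro: span_add span_scale)
  moreover have "scale c x + z = sum g (insert w F)"
  proof -
    have "sum g (insert w F) = g w + sum g (F - {w})"
      using f(1) by (simp add: sum.insert_remove)
    moreover have "sum g (F - {w}) = sum f (F - {w})"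
      by (rule sum.cong) (auto simp: g_def)
    moreover have "f w + sum f (F - {w}) = sum f F"
      using f(1,4) by (cases "w \<in> F") (simp_all add: sum.remove)
    ultimately show ?thesis
      using f(5) by (simp add: g_def add.assoc)
  qed
  moreover have "insert w F \<subseteq> lists S"
    using f(2) ws(3) by (auto simp: w_def)
  moreover have "v \<notin> insert w F \<Longrightarrow> g v = 0" for v
    using f(4) by (simp add: g_def)
  ultimately show ?case
    using f(1) by (intro exI[of _ g] exI[of _ "insert w F"]) auto
qed

subsection \<open>Correlation of polynomials in partial sums\<close>

lemma norm2_sum_orthogonal:
  assumes "\<And>w v. w \<in> F \<Longrightarrow> v \<in> F \<Longrightarrow> w \<noteq> v \<Longrightarrow> ip (g w) (g v) = 0"
  shows "(norm2 (sum g F))\<^sup>2 = (\<Sum>w\<in>F. (norm2 (g w))\<^sup>2)"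
proof (cases "finite F")
  case True
  have "ip (sum g F) (sum g F) = (\<Sum>w\<in>F. \<Sum>v\<in>F. ip (g w) (g v))"
    by (simp add: ip_sum_left ip_sum_right) (rule sum.swap)
  also have "\<dots> = (\<Sum>w\<in>F. ip (g w) (g w))"
  proof (rule sum.cong[OF refl])
    fix w assume w: "w \<in> F"
    have "(\<Sum>v\<in>F. ip (g w) (g v)) = (\<Sum>v\<in>{w}. ip (g w) (g v))"
      using True w assms by (intro sum.mono_neutral_right) auto
    then show "(\<Sum>v\<in>F. ip (g w) (g v)) = ip (g w) (g w)" by simp
  qed
  finally show ?thesis
    by (simp add: norm2_sq)
qed (simp add: norm2_sq)

lemma norm2_sum_le: "norm2 (sum f K) \<le> (\<Sum>i\<in>K. norm2 (f i))"
proof (induction K rule: infinite_finite_induct)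
  case (insert i K)
  then show ?case
    using norm2_triangle[of "f i" "sum f K"] by simp
qed (simp_all add: norm2_eq_0[THEN iffD2])

lemma norm2_sum_sq_le: "(norm2 (sum f K))\<^sup>2 \<le> real (card K) * (\<Sum>i\<in>K. (norm2 (f i))\<^sup>2)"
proof -
  have "(norm2 (sum f K))\<^sup>2 \<le> (\<Sum>i\<in>K. norm2 (f i))\<^sup>2"
    by (intro power_mono norm2_sum_le norm2_nonneg)
  also have "\<dots> \<le> real (card K) * (\<Sum>i\<in>K. (norm2 (f i))\<^sup>2)"
    using sum_squared_le_sum_of_squares[of "\<lambda>i. norm2 (f i)" K] by (simp add: mult.commute)
  finally show ?thesis .
qed

text \<open>Each reduced word that occurs in the sum misses the \<open>u i\<close> with \<open>i\<close> among its letters,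
  so at most \<open>card I - 1\<close> of its components add up.\<close>

lemma norm2_sum_leave_one_out:
  assumes free: "poly_free I y" and self: "\<And>i. i \<in> I \<Longrightarrow> star (y i) = y i" and fin: "finite I"
    and u: "\<And>i. i \<in> I \<Longrightarrow> u i \<in> span (reduced_words y (I - {i}))"
    and centered: "\<And>i. i \<in> I \<Longrightarrow> \<tau> (u i) = 0"
  shows "(norm2 (\<Sum>i\<in>I. u i))\<^sup>2 \<le> real (card I - 1) * (\<Sum>i\<in>I. (norm2 (u i))\<^sup>2)"
proof -
  define Q where "Q i f F \<longleftrightarrow> finite F \<and> F \<subseteq> lists (I - {i}) \<and> (\<forall>w. f w \<in> component y w) \<and>
      (\<forall>w. w \<notin> F \<longrightarrow> f w = 0) \<and> u i = sum f F" for i f F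
  have "\<forall>i\<in>I. \<exists>f F. Q i f F"
    unfolding Q_def using span_reduced_words_decomp[OF u] by (rule ballI)
  then obtain f F where "\<And>i. i \<in> I \<Longrightarrow> Q i (f i) (F i)"
    by metis
  then have f: "\<And>i. i \<in> I \<Longrightarrow> finite (F i)" "\<And>i. i \<in> I \<Longrightarrow> F i \<subseteq> lists (I - {i})"
    "\<And>i w. i \<in> I \<Longrightarrow> f i w \<in> component y w" "\<And>i w. i \<in> I \<Longrightarrow> w \<notin> F i \<Longrightarrow> f i w = 0"
    "\<And>i. i \<in> I \<Longrightarrow> u i = sum (f i) (F i)"
    unfolding Q_def by simp_all
  define E where "E = (\<Union>i\<in>I. F i)"
  have E: "finite E" "E \<subseteq> lists I"
    unfolding E_def using fin f(1) by (simp, intro UN_least order_trans[OF f(2) lists_mono]) auto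
  have ui: "u i = sum (f i) E" if "i \<in> I" for i
    unfolding f(5)[OF that]
    by (rule sum.mono_neutral_left) (use that f(4) E(1) in \<open>auto simp: E_def\<close>)
  have orth: "ip a b = 0" if "a \<in> component y w" "b \<in> component y v" "w \<noteq> v" "w \<in> lists I" "v \<in> lists I"
    for a b w v
    by (rule ip_component[OF free self that(1,2,3)]) (use that in auto)
  \<comment> \<open>The empty pattern contains no letter to leave out, so its component has to
    vanish altogether. It is the scalar part of \<open>u i\<close>, and \<open>u i\<close> is
    centered.\<close>
  have nil: "f i [] = 0" if i: "i \<in> I" for i
  proof -
    have one: "1 \<in> component y []"
      unfolding component_def by (rule span_base) (auto intro: exI[of _ "[]"])
    have "component y [] = span {1}"
      unfolding component_def by (rule arg_cong[of _ _ span]) auto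
    then obtain c where c: "f i [] = scale c 1"
      using f(3)[OF i, of "[]"] by (auto simp: span_singleton)
    have "0 = ip 1 (u i)"
      using centered[OF i] by (simp add: ip_def)
    also have "\<dots> = (\<Sum>w\<in>E. ip 1 (f i w))"
      by (simp add: ui[OF i] ip_sum_right)
    also have "\<dots> = (\<Sum>w\<in>E. if w = [] then c else 0)"
    proof (rule sum.cong[OF refl])
      fix w assume "w \<in> E"
      then show "ip 1 (f i w) = (if w = [] then c else 0)"
        using orth[OF one f(3)[OF i], of w] E(2) c
        by (cases "w = []") (auto simp: ip_def tau_scale tau_one)
    qed
    finally have "[] \<in> E \<Longrightarrow> c = 0"
      using E(1) by simp
    then show ?thesis
      using c f(4)[OF i] i by (cases "[] \<in> F i") (auto simp: E_def)
  qed
  have "(norm2 (\<Sum>i\<in>I. u i))\<^sup>2 = (norm2 (\<Sum>w\<in>E. \<Sum>i\<in>I. f i w))\<^sup>2"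
    using ui sum.swap[of f E I] by simp
  also have "\<dots> = (\<Sum>w\<in>E. (norm2 (\<Sum>i\<in>I. f i w))\<^sup>2)"
  proof (rule norm2_sum_orthogonal)
    fix w v assume "w \<in> E" "v \<in> E" "w \<noteq> v"
    then have "ip (f i w) (f k v) = 0" if "i \<in> I" "k \<in> I" for i k
      using orth[OF f(3)[OF that(1)] f(3)[OF that(2)]] E(2) by blast
    then show "ip (\<Sum>i\<in>I. f i w) (\<Sum>i\<in>I. f i v) = 0"
      by (simp add: ip_sum_left ip_sum_right)
  qed
  also have "\<dots> \<le> (\<Sum>w\<in>E. real (card I - 1) * (\<Sum>i\<in>I. (norm2 (f i w))\<^sup>2))"
  proof (rule sum_mono)
    fix w assume w: "w \<in> E"
    show "(norm2 (\<Sum>i\<in>I. f i w))\<^sup>2 \<le> real (card I - 1) * (\<Sum>i\<in>I. (norm2 (f i w))\<^sup>2)"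
    proof (cases w)
      case Nil
      then show ?thesis by (simp add: nil sum_nonneg norm2_eq_0[THEN iffD2])
    next
      case (Cons j v)
      have "j \<in> I" "w \<notin> lists (I - {j})"
        using w E(2) Cons by auto
      then have j: "j \<in> I" "f j w = 0"
        using f(2)[of j] by (blast, intro f(4)) blast+
      have "(norm2 (\<Sum>i\<in>I. f i w))\<^sup>2 = (norm2 (\<Sum>i\<in>I - {j}. f i w))\<^sup>2"
        using j fin by (simp add: sum.remove)
      also have "\<dots> \<le> real (card (I - {j})) * (\<Sum>i\<in>I - {j}. (norm2 (f i w))\<^sup>2)"
        by (rule norm2_sum_sq_le)
      also have "\<dots> \<le> real (card I - 1) * (\<Sum>i\<in>I. (norm2 (f i w))\<^sup>2)"
        using j fin by (intro mult_mono sum_mono2) (auto intro: sum_nonneg)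
      finally show ?thesis .
    qed
  qed
  also have "\<dots> = real (card I - 1) * (\<Sum>i\<in>I. \<Sum>w\<in>E. (norm2 (f i w))\<^sup>2)"
    by (simp add: sum_distrib_left sum.swap[of _ E I])
  also have "(\<Sum>i\<in>I. \<Sum>w\<in>E. (norm2 (f i w))\<^sup>2) = (\<Sum>i\<in>I. (norm2 (u i))\<^sup>2)"
  proof (rule sum.cong[OF refl])
    fix i assume i: "i \<in> I"
    show "(\<Sum>w\<in>E. (norm2 (f i w))\<^sup>2) = (norm2 (u i))\<^sup>2"
      unfolding ui[OF i]
    proof (rule norm2_sum_orthogonal[symmetric])
      fix w v assume "w \<in> E" "v \<in> E" "w \<noteq> v"
      then show "ip (f i w) (f i v) = 0"
        using orth[OF f(3)[OF i] f(3)[OF i]] E(2) by blast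
    qed
  qed
  finally show ?thesis .
qed

section \<open>Joint moments of free families and exchangeability\<close>

lemma tau_ev_cong:
  assumes "poly_free I y" "poly_free I y'"
    and law: "\<And>i p. i \<in> I \<Longrightarrow> \<tau> (pev (y i) p) = \<tau> (pev (y' i) p)"
  shows "fst ` set ws \<subseteq> I \<Longrightarrow> \<tau> (ev y ws) = \<tau> (ev y' ws)"
proof (induction ws rule: reduced_word_induct[where y = y])
  case (merge u v i p q)
  then show ?case by (simp add: pev_mult mult.assoc)
next
  case (split u v i p c)
  have "\<tau> (ev y (u @ (i, p - [:c:]) # v)) = \<tau> (ev y' (u @ (i, p - [:c:]) # v))"
    "\<tau> (ev y (u @ v)) = \<tau> (ev y' (u @ v))"
    using split by auto
  then show ?case
    by (simp add: pev_diff left_diff_distrib right_diff_distrib tau_diff scale_mult_left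
        scale_mult_right tau_scale)
next
  case (reduced ws)
  \<comment> \<open>Equal laws center the same letters, so the word is reduced for both families and
    both traces are zero.\<close>
  have "\<forall>(i, p)\<in>set ws. \<tau> (pev (y' i) p) = 0"
    using reduced law by (force simp: reduced_def)
  with reduced have "reduced y' ws"
    by (simp add: reduced_def)
  with reduced show ?case
    using poly_freeD[OF assms(1)] poly_freeD[OF assms(2)] by (cases "ws = []") auto
qed

text \<open>Testing against all words on the left makes the relation survive left multiplication by
  a polynomial in a sum; the empty word returns equality of the traces.\<close>

definition same_moments :: "'i set \<Rightarrow> ('i \<Rightarrow> 'a) \<Rightarrow> ('i \<Rightarrow> 'a) \<Rightarrow> 'a \<Rightarrow> 'a \<Rightarrow> bool" where
  "same_moments I y y' a a' \<longleftrightarrow>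
     (\<forall>u. fst ` set u \<subseteq> I \<longrightarrow> \<tau> (ev y u * a) = \<tau> (ev y' u * a'))"

lemma same_moments_pev_sum:
  assumes "same_moments I y y' a a'" "finite S" "S \<subseteq> I"
  shows "same_moments I y y' (pev (\<Sum>i\<in>S. y i) p * a) (pev (\<Sum>i\<in>S. y' i) p * a')"
  unfolding same_moments_def
proof (intro allI impI)
  fix u :: "('b \<times> complex poly) list" assume "fst ` set u \<subseteq> I"
  then show "\<tau> (ev y u * (pev (\<Sum>i\<in>S. y i) p * a)) = \<tau> (ev y' u * (pev (\<Sum>i\<in>S. y' i) p * a'))"
  proof (induction p arbitrary: u)
    case (pCons c p)
    have expand: "ev z u * (pev (\<Sum>i\<in>S. z i) (pCons c p) * b) = scale c (ev z u * b)
        + (\<Sum>i\<in>S. ev z (u @ [(i, [:0, 1:])]) * (pev (\<Sum>i\<in>S. z i) p * b))" for z b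
      by (simp add: distrib_left distrib_right scale_mult_left scale_mult_right
          sum_distrib_left sum_distrib_right mult.assoc)
    have "(\<Sum>i\<in>S. \<tau> (ev y (u @ [(i, [:0, 1:])]) * (pev (\<Sum>i\<in>S. y i) p * a)))
        = (\<Sum>i\<in>S. \<tau> (ev y' (u @ [(i, [:0, 1:])]) * (pev (\<Sum>i\<in>S. y' i) p * a')))"
      by (rule sum.cong[OF refl], rule pCons.IH) (use pCons.prems assms(3) in auto)
    moreover have "\<tau> (ev y u * a) = \<tau> (ev y' u * a')"
      using assms(1) pCons.prems by (simp add: same_moments_def)
    ultimately show ?case
      unfolding expand tau_add tau_scale tau_sum by (simp only:)
  qed simp
qed

lemma poly_free_reindex:
  assumes free: "poly_free I y" and \<sigma>: "inj_on \<sigma> I" "\<sigma> ` I \<subseteq> I"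
  shows "poly_free I (\<lambda>i. y (\<sigma> i))"
  unfolding poly_free_def
proof (intro allI impI)
  fix ws :: "('b \<times> complex poly) list"
  assume ws: "reduced (\<lambda>i. y (\<sigma> i)) ws" "ws \<noteq> []" "fst ` set ws \<subseteq> I"
  let ?v = "map (apfst \<sigma>) ws"
  have fst: "map fst ?v = map \<sigma> (map fst ws)"
    by simp
  have "reduced y ?v"
    using ws(1) distinct_adj_mapI[OF _ inj_on_subset[OF \<sigma>(1)], of "map fst ws"] ws(3)
    unfolding reduced_def fst by auto
  moreover have "fst ` set ?v \<subseteq> I"
    using ws(3) \<sigma>(2) by (force simp: image_image)
  moreover have "ev y ?v = ev (\<lambda>i. y (\<sigma> i)) ws"
    by (simp add: ev_def split_def comp_def)
  ultimately show "\<tau> (ev (\<lambda>i. y (\<sigma> i)) ws) = 0"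
    using poly_freeD[OF free] ws(2) by (metis Nil_is_map_conv)
qed

text \<open>Centering is an orthogonal projection.\<close>

lemma norm2_centered_le: "norm2 (a - scale (\<tau> a) 1) \<le> norm2 a"
proof (rule power2_le_imp_le[OF _ norm2_nonneg])
  have "ip (a - scale (\<tau> a) 1) (a - scale (\<tau> a) 1) = ip a a - of_real ((cmod (\<tau> a))\<^sup>2)"
    by (simp only: ip_diff_left ip_diff_right ip_scale_left ip_scale_right complex_norm_square)
      (simp add: ip_def tau_one tau_star algebra_simps)
  then show "(norm2 (a - scale (\<tau> a) 1))\<^sup>2 \<le> (norm2 a)\<^sup>2"
    by (simp add: norm2_sq)
qed

text \<open>The transposition of \<open>i\<close> and \<open>j\<close> preserves the joint moments
  and the full sum, and carries one partial sum to the other.\<close>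

lemma tau_pev_leave_one_out:
  assumes free: "poly_free I y" and fin: "finite I" and "i \<in> I" "j \<in> I"
    and law: "\<And>i j p. i \<in> I \<Longrightarrow> j \<in> I \<Longrightarrow> \<tau> (pev (y i) p) = \<tau> (pev (y j) p)"
  shows "\<tau> (pev (\<Sum>k\<in>I - {i}. y k) p * pev (\<Sum>k\<in>I. y k) q)
    = \<tau> (pev (\<Sum>k\<in>I - {j}. y k) p * pev (\<Sum>k\<in>I. y k) q)"
proof -
  define \<sigma> where "\<sigma> = Transposition.transpose i j"
  have bij: "bij_betw \<sigma> I I" "bij_betw \<sigma> (I - {i}) (I - {j})"
    unfolding \<sigma>_def bij_betw_def using assms(3,4)
    by (auto simp: Transposition.transpose_def inj_on_def image_iff split: if_splits)
  have free': "poly_free I (\<lambda>i. y (\<sigma> i))"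
    using bij(1) by (intro poly_free_reindex[OF free]) (auto simp: bij_betw_def)
  have "same_moments I (\<lambda>i. y (\<sigma> i)) y 1 1"
    unfolding same_moments_def using bij(1)
    by (auto intro!: tau_ev_cong[OF free' free] law simp: bij_betw_def)
  from same_moments_pev_sum[OF same_moments_pev_sum[OF this fin order_refl], of "I - {i}" p q]
  have "same_moments I (\<lambda>i. y (\<sigma> i)) y
      (pev (\<Sum>k\<in>I - {i}. y (\<sigma> k)) p * (pev (\<Sum>k\<in>I. y (\<sigma> k)) q * 1))
      (pev (\<Sum>k\<in>I - {i}. y k) p * (pev (\<Sum>k\<in>I. y k) q * 1))"
    using fin by simp
  from this[unfolded same_moments_def, rule_format, of "[]"] show ?thesis
    by (simp add: sum.reindex_bij_betw[OF bij(1)] sum.reindex_bij_betw[OF bij(2)])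
qed

theorem correlation_leave_one_out:
  assumes free: "poly_free I y" and self: "\<And>i. i \<in> I \<Longrightarrow> star (y i) = y i"
    and fin: "finite I" and j: "j \<in> I"
    and law: "\<And>i j p. i \<in> I \<Longrightarrow> j \<in> I \<Longrightarrow> \<tau> (pev (y i) p) = \<tau> (pev (y j) p)"
  defines "s \<equiv> \<Sum>k\<in>I - {j}. y k" and "t \<equiv> \<Sum>k\<in>I. y k"
  shows "cmod (ip (pev s p) (pev t q) - cnj (\<tau> (pev s p)) * \<tau> (pev t q))
    \<le> sqrt (real (card I - 1) / real (card I)) * (norm2 (pev s p) * norm2 (pev t q))"
proof -
  \<comment> \<open>\<open>v i\<close> is \<open>t - y i\<close>. By exchangeability each
    \<open>v i\<close> has the same moments as \<open>s = v j\<close> and the same mixed moments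
    with \<open>t\<close>.\<close>
  define v where "v i = (\<Sum>k\<in>I - {i}. y k)" for i
  define c where "c = \<tau> (pev s p)"
  define u where "u i = pev (v i) p - scale c 1" for i
  let ?N = "real (card I)"
  have N: "0 < ?N"
    using fin j by (auto simp: card_gt_0_iff)
  have vself: "star (v i) = v i" for i
    unfolding v_def star_sum using self by (intro sum.cong) auto
  have eq: "\<tau> (pev (v i) p * pev t q) = \<tau> (pev s p * pev t q)" if "i \<in> I" for i p q
    unfolding v_def t_def s_def by (rule tau_pev_leave_one_out[OF free fin that j law])
  have s: "s = v j"
    by (simp add: s_def v_def)
  have tau: "\<tau> (pev (v i) r) = \<tau> (pev s r)" if "i \<in> I" for i r
    using eq[OF that, of r 1] by simp
  have ipq: "ip (pev (v i) p) (pev t q) = ip (pev s p) (pev t q)" if "i \<in> I" for i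
    using eq[OF that, of "map_poly cnj p" q] by (simp add: ip_def s star_pev vself)
  have nrm: "norm2 (pev (v i) p) = norm2 (pev s p)" if "i \<in> I" for i
    using tau[OF that, of "map_poly cnj p * p"]
    by (simp add: norm2_def ip_def s star_pev vself pev_mult)
  have nu: "norm2 (u i) \<le> norm2 (pev s p)" if "i \<in> I" for i
    using norm2_centered_le[of "pev (v i) p"] by (simp add: u_def c_def tau[OF that] nrm[OF that])
  have "(norm2 (\<Sum>i\<in>I. u i))\<^sup>2 \<le> real (card I - 1) * (\<Sum>i\<in>I. (norm2 (u i))\<^sup>2)"
  proof (rule norm2_sum_leave_one_out[OF free self fin])
    fix i assume i: "i \<in> I"
    have "1 \<in> span (reduced_words y (I - {i}))"
      using ev_in_span_reduced_words[of "[]"] by simp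
    then show "u i \<in> span (reduced_words y (I - {i}))"
      unfolding u_def v_def using fin
      by (intro span_diff span_scale pev_sum_in_span_reduced_words) auto
    show "\<tau> (u i) = 0"
      by (simp add: u_def tau_diff tau_scale tau_one c_def tau[OF i])
  qed
  also have "(\<Sum>i\<in>I. (norm2 (u i))\<^sup>2) \<le> (\<Sum>i\<in>I. (norm2 (pev s p))\<^sup>2)"
    by (intro sum_mono power_mono nu norm2_nonneg)
  finally have "(norm2 (\<Sum>i\<in>I. u i))\<^sup>2 \<le> real (card I - 1) * (?N * (norm2 (pev s p))\<^sup>2)"
    by (simp add: mult_left_mono)
  then have "norm2 (\<Sum>i\<in>I. u i) \<le> sqrt (real (card I - 1) * (?N * (norm2 (pev s p))\<^sup>2))"
    by (rule real_le_rsqrt)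
  also have "\<dots> = ?N * (sqrt (real (card I - 1) / ?N) * norm2 (pev s p))"
  proof -
    have "real (card I - 1) * (?N * (norm2 (pev s p))\<^sup>2)
        = ?N\<^sup>2 * ((real (card I - 1) / ?N) * (norm2 (pev s p))\<^sup>2)"
      using N by (simp add: field_simps power2_eq_square)
    then show ?thesis
      by (simp only: real_sqrt_mult real_sqrt_abs) (simp add: norm2_nonneg)
  qed
  finally have sum_le: "norm2 (\<Sum>i\<in>I. u i) \<le> ?N * (sqrt (real (card I - 1) / ?N) * norm2 (pev s p))" .
  \<comment> \<open>All summands have the same correlation with \<open>pev t q\<close>, so the sum
    yields \<open>card I\<close> copies of it, against a norm that is only of order
    \<open>sqrt (card I * (card I - 1))\<close>.\<close>
  have "ip (\<Sum>i\<in>I. u i) (pev t q) = (\<Sum>i\<in>I. ip (pev s p) (pev t q) - cnj c * \<tau> (pev t q))"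
    unfolding ip_sum_left
    by (rule sum.cong[OF refl]) (simp add: u_def ip_diff_left ip_scale_left ipq, simp add: ip_def)
  also have "\<dots> = of_real ?N * (ip (pev s p) (pev t q) - cnj c * \<tau> (pev t q))"
    by simp
  finally have "?N * cmod (ip (pev s p) (pev t q) - cnj c * \<tau> (pev t q))
      = cmod (ip (\<Sum>i\<in>I. u i) (pev t q))"
    by (simp add: norm_mult)
  also have "\<dots> \<le> norm2 (\<Sum>i\<in>I. u i) * norm2 (pev t q)"
    by (rule Cauchy_Schwarz2)
  also have "\<dots> \<le> ?N * (sqrt (real (card I - 1) / ?N) * norm2 (pev s p)) * norm2 (pev t q)"
    by (rule mult_right_mono[OF sum_le norm2_nonneg])
  also have "\<dots> = ?N * (sqrt (real (card I - 1) / ?N) * (norm2 (pev s p) * norm2 (pev t q)))"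
    by simp
  finally show ?thesis
    using N by (simp add: c_def mult_le_cancel_left)
qed

subsection \<open>The conjugate functional of a free sum\<close>

text \<open>Split \<open>q\<close> into its centered part and a constant: the first extends
  \<open>u\<close> to a reduced word, the second leaves a multiple of \<open>u\<close>, and both
  traces vanish.\<close>

lemma tau_ev_pev_eq_0:
  assumes free: "poly_free I y" and u: "reduced y u" "u \<noteq> []" "fst ` set u \<subseteq> I" and i: "i \<in> I"
  shows "fst (last u) \<noteq> i \<Longrightarrow> \<tau> (ev y u * pev (y i) q) = 0"
    and "fst (hd u) \<noteq> i \<Longrightarrow> \<tau> (pev (y i) q * ev y u) = 0"
proof -
  define c where "c = \<tau> (pev (y i) q)"
  have u0: "\<tau> (ev y u) = 0"
    by (rule poly_freeD[OF free u])
  have c: "\<tau> (pev (y i) (q - [:c:])) = 0"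
    by (simp add: pev_diff tau_diff tau_scale tau_one c_def)
  {
    assume "fst (last u) \<noteq> i"
    with u c have "reduced y (u @ [(i, q - [:c:])])"
      by (simp add: reduced_append reduced_Cons)
    then have "\<tau> (ev y (u @ [(i, q - [:c:])])) = 0"
      by (rule poly_freeD[OF free]) (use u i in auto)
    then show "\<tau> (ev y u * pev (y i) q) = 0"
      using u0 by (simp add: pev_diff right_diff_distrib scale_mult_right tau_diff tau_scale)
  next
    assume "fst (hd u) \<noteq> i"
    with u c have "reduced y ((i, q - [:c:]) # u)"
      by (auto simp: reduced_Cons)
    then have "\<tau> (ev y ((i, q - [:c:]) # u)) = 0"
      by (rule poly_freeD[OF free]) (use u i in auto)
    then show "\<tau> (pev (y i) q * ev y u) = 0"
      using u0 by (simp add: pev_diff left_diff_distrib scale_mult_left tau_diff tau_scale)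
  }
qed

text \<open>\<open>dw y j a b ws\<close> is \<open>(\<tau> \<otimes> \<tau>) (a \<cdot> \<partial>ws \<cdot> b)\<close> for the derivation with \<open>\<partial>(y j) = 1 \<otimes> 1\<close>
  that kills the other variables.  It is defined on formal words, since \<open>\<partial>\<close> need not
  descend to the algebra.\<close>

primrec dw :: "('i \<Rightarrow> 'a) \<Rightarrow> 'i \<Rightarrow> 'a \<Rightarrow> 'a \<Rightarrow> ('i \<times> complex poly) list \<Rightarrow> complex" where
  "dw y j a b [] = 0"
| "dw y j a b (w # ws) = (if fst w = j then dq (y j) (snd w) a (ev y ws * b) else 0)
     + dw y j (a * pev (y (fst w)) (snd w)) b ws"

lemma dw_append: "dw y j a b (u @ v) = dw y j a (ev y v * b) u + dw y j (a * ev y u) b v"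
  by (induction u arbitrary: a) (auto simp: mult.assoc)

lemma dw_left_add: "dw y j (a + a') b ws = dw y j a b ws + dw y j a' b ws"
  by (induction ws arbitrary: a a') (auto simp: dq_left_add distrib_right)

lemma dw_left_scale: "dw y j (scale c a) b ws = c * dw y j a b ws"
  by (induction ws arbitrary: a) (auto simp: dq_left_scale scale_mult_left distrib_left)

lemma dw_right_add: "dw y j a (b + b') ws = dw y j a b ws + dw y j a b' ws"
  by (induction ws arbitrary: a) (auto simp: dq_right_add distrib_left)

lemma dw_right_scale: "dw y j a (scale c b) ws = c * dw y j a b ws"
  by (induction ws arbitrary: a) (auto simp: dq_right_scale scale_mult_right distrib_left)

lemma dw_right_0 [simp]: "dw y j a 0 ws = 0"
  using dw_right_scale[of y j a 0 0 ws] by simp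

lemma dw_right_sum: "dw y j a (sum f A) ws = (\<Sum>k\<in>A. dw y j a (f k) ws)"
  by (induction A rule: infinite_finite_induct) (simp_all add: dw_right_add)

text \<open>Differentiating a letter \<open>j\<close> leaves a non-empty reduced word on at least
  one side. Its index next to the letter differs from \<open>j\<close>, so its trace against every
  polynomial in \<open>y j\<close> is zero. The prefix \<open>u\<close> collects the letters already
  passed.\<close>

lemma dw_reduced_eq_0:
  assumes free: "poly_free I y" and j: "j \<in> I"
    and "reduced y (u @ ws)" "fst ` set (u @ ws) \<subseteq> I" "\<And>p. u @ ws \<noteq> [(j, p)]"
  shows "dw y j (ev y u) 1 ws = 0"
  using assms(3-)
proof (induction ws arbitrary: u)
  case (Cons w ws)
  obtain i p where w: "w = (i, p)" by (cases w)
  have "dw y j (ev y (u @ [w])) 1 ws = 0"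
    using Cons.prems by (intro Cons.IH) auto
  moreover have "dq (y j) p (ev y u) (ev y ws) = 0" if "i = j"
  proof (cases "u = []")
    case False
    then show ?thesis
      using Cons.prems that j
      by (intro dq_eq_0_left tau_ev_pev_eq_0(1)[OF free]) (auto simp: reduced_append w)
  next
    case True
    then have "ws \<noteq> []"
      using Cons.prems(3) that w by auto
    then show ?thesis
      using Cons.prems that j True
      by (intro dq_eq_0_right tau_ev_pev_eq_0(2)[OF free]) (auto simp: reduced_Cons w)
  qed
  ultimately show ?case
    by (simp add: w)
qed simp

text \<open>\<open>\<Xi>\<close> models the pairing with a conjugate variable of \<open>y j\<close>,
  which remains conjugate in the presence of variables free from \<open>y j\<close>. Both sides
  respect merging and splitting, so reduced words suffice; there both vanish except on a single
  letter \<open>j\<close>, where \<open>conj\<close> applies.\<close>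

lemma functional_ev_eq_dw:
  assumes free: "poly_free I y" and j: "j \<in> I"
    and add: "\<And>a b. \<Xi> (a + b) = \<Xi> a + \<Xi> b" and scale: "\<And>c a. \<Xi> (scale c a) = c * \<Xi> a"
    and conj: "\<And>p. \<Xi> (pev (y j) p) = conj_functional (y j) p"
    and vanish: "\<And>ws. reduced y ws \<Longrightarrow> fst ` set ws \<subseteq> I \<Longrightarrow> ws \<noteq> [] \<Longrightarrow> (\<And>p. ws \<noteq> [(j, p)])
      \<Longrightarrow> \<Xi> (ev y ws) = 0"
  shows "fst ` set ws \<subseteq> I \<Longrightarrow> \<Xi> (ev y ws) = dw y j 1 1 ws"
proof (induction ws rule: reduced_word_induct[where y = y])
  case (merge u v i p q)
  then show ?case
    by (simp add: dw_append dq_mult pev_mult mult.assoc)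
next
  case (split u v i p c)
  define q where "q = p - [:c:]"
  have p: "p = q + [:c:]"
    by (simp add: q_def)
  have "\<Xi> (ev y (u @ (i, q) # v)) = dw y j 1 1 (u @ (i, q) # v)" "\<Xi> (ev y (u @ v)) = dw y j 1 1 (u @ v)"
    using split unfolding q_def by auto
  moreover have "ev y (u @ (i, p) # v) = ev y (u @ (i, q) # v) + scale c (ev y (u @ v))"
    by (simp add: p pev_add distrib_left distrib_right scale_mult_left scale_mult_right)
  moreover have "dw y j 1 1 (u @ (i, p) # v) = dw y j 1 1 (u @ (i, q) # v) + c * dw y j 1 1 (u @ v)"
    by (simp add: p dw_append dq_add pev_add distrib_left distrib_right scale_mult_left
        scale_mult_right dw_left_add dw_left_scale dw_right_add dw_right_scale)
  ultimately show ?case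
    by (simp only: add scale)
next
  case (reduced ws)
  consider "ws = []" | p where "ws = [(j, p)]" | "ws \<noteq> []" "\<And>p. ws \<noteq> [(j, p)]"
    by blast
  then show ?case
  proof cases
    case 1
    then show ?thesis
      using conj[of 1] by (simp add: one_pCons)
  next
    case 2
    then show ?thesis
      by (simp add: conj)
  next
    case 3
    then show ?thesis
      using dw_reduced_eq_0[OF free j, of "[]" ws] reduced vanish[of ws] by simp
  qed
qed

text \<open>The derivation with respect to \<open>y j\<close> sends the sum \<open>t\<close> to 1
  \<otimes> 1, so on polynomials in \<open>t\<close> it is the difference quotient in
  \<open>t\<close>.\<close>

lemma functional_pev_sum:
  fixes y :: "'i \<Rightarrow> 'a"
  assumes fin: "finite I" and free: "poly_free I y" and j: "j \<in> I"
    and add: "\<And>a b. \<Xi> (a + b) = \<Xi> a + \<Xi> b" and scale: "\<And>c a. \<Xi> (scale c a) = c * \<Xi> a"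
    and conj: "\<And>p. \<Xi> (pev (y j) p) = conj_functional (y j) p"
    and vanish: "\<And>ws. reduced y ws \<Longrightarrow> fst ` set ws \<subseteq> I \<Longrightarrow> ws \<noteq> [] \<Longrightarrow> (\<And>p. ws \<noteq> [(j, p)])
      \<Longrightarrow> \<Xi> (ev y ws) = 0"
  shows "\<Xi> (pev (\<Sum>i\<in>I. y i) p) = conj_functional (\<Sum>i\<in>I. y i) p"
proof -
  define t where "t = (\<Sum>i\<in>I. y i)"
  have zero: "\<Xi> 0 = 0"
    using scale[of 0 0] by simp
  have sum: "\<Xi> (sum f A) = (\<Sum>k\<in>A. \<Xi> (f k))" for f and A :: "'i set"
    by (induction A rule: infinite_finite_induct) (simp_all add: zero add)
  have sum': "\<Xi> (sum f A) = (\<Sum>k\<in>A. \<Xi> (f k))" for f and A :: "nat set"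
    by (induction A rule: infinite_finite_induct) (simp_all add: zero add)
  have base: "\<Xi> (ev y u) = dw y j 1 1 u" if "fst ` set u \<subseteq> I" for u
    by (rule functional_ev_eq_dw[where \<Xi> = \<Xi>, OF free j _ _ _ _ that])
      (fact add scale conj vanish)+
  \<comment> \<open>The first term differentiates the prefix \<open>u\<close>, the second the power
    of \<open>t\<close>. The induction on \<open>r\<close> moves one letter at a time from the power
    into the prefix.\<close>
  have "\<Xi> (ev y u * t ^ r) = dw y j 1 (t ^ r) u + (\<Sum>k<r. \<tau> (ev y u * t ^ k) * \<tau> (t ^ (r - 1 - k)))"
    if "fst ` set u \<subseteq> I" for u r
    using that
  proof (induction r arbitrary: u)
    case 0
    then show ?case
      using base by simp
  next
    case (Suc r)
    let ?v = "\<lambda>i. u @ [(i, [:0, 1:])]"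
    have v: "ev y (?v i) * b = ev y u * (y i * b)" for i b
      by (simp add: mult.assoc)
    have "\<Xi> (ev y u * t ^ Suc r) = (\<Sum>i\<in>I. \<Xi> (ev y (?v i) * t ^ r))"
      unfolding v sum[symmetric] sum_distrib_left[symmetric] sum_distrib_right[symmetric]
      by (simp add: t_def)
    also have "\<dots> = (\<Sum>i\<in>I. dw y j 1 (t ^ r) (?v i)
        + (\<Sum>k<r. \<tau> (ev y (?v i) * t ^ k) * \<tau> (t ^ (r - 1 - k))))"
      using Suc.prems by (intro sum.cong refl Suc.IH) auto
    also have "\<dots> = (\<Sum>i\<in>I. dw y j 1 (t ^ r) (?v i))
        + (\<Sum>k<r. \<Sum>i\<in>I. \<tau> (ev y (?v i) * t ^ k) * \<tau> (t ^ (r - 1 - k)))"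
      by (subst sum.swap) (simp only: sum.distrib)
    also have "(\<Sum>i\<in>I. dw y j 1 (t ^ r) (?v i))
        = (\<Sum>i\<in>I. dw y j 1 (y i * t ^ r) u) + (\<Sum>i\<in>I. if i = j then \<tau> (ev y u) * \<tau> (t ^ r) else 0)"
      unfolding sum.distrib[symmetric] by (rule sum.cong) (auto simp: dw_append)
    also have "(\<Sum>i\<in>I. dw y j 1 (y i * t ^ r) u) = dw y j 1 (t ^ Suc r) u"
      by (simp add: dw_right_sum[symmetric] sum_distrib_right[symmetric] t_def)
    also have "(\<Sum>i\<in>I. if i = j then \<tau> (ev y u) * \<tau> (t ^ r) else 0) = \<tau> (ev y u) * \<tau> (t ^ r)"
      using fin j by simp
    also have "(\<Sum>k<r. \<Sum>i\<in>I. \<tau> (ev y (?v i) * t ^ k) * \<tau> (t ^ (r - 1 - k)))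
        = (\<Sum>k<r. \<tau> (ev y u * t ^ Suc k) * \<tau> (t ^ (r - 1 - k)))"
      unfolding v sum_distrib_right[symmetric] tau_sum[symmetric] sum_distrib_left[symmetric]
      by (simp add: t_def)
    finally show ?case
      by (simp add: sum.lessThan_Suc_shift del: sum.lessThan_Suc power_Suc)
  qed
  from this[of "[]"] have pow: "\<Xi> (t ^ r) = conj_functional t (monom 1 r)" for r
    by (simp add: conj_functional_monom)
  have "\<Xi> (pev t p) = conj_functional t p"
    unfolding pev_altdef dq_altdef[of t p] sum' scale pow ..
  then show ?thesis
    by (simp add: t_def)
qed

section \<open>Freeness of sums over disjoint blocks\<close>

lemma poly_free_partial_sums:
  assumes free: "poly_free I x" and S: "\<And>k. finite (S k)" "\<And>k. S k \<subseteq> I"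
    and disj: "\<And>k l. k \<noteq> l \<Longrightarrow> S k \<inter> S l = {}"
  shows "poly_free K (\<lambda>k. \<Sum>i\<in>S k. x i)"
proof -
  let ?y = "\<lambda>k. \<Sum>i\<in>S k. x i"
  \<comment> \<open>\<open>R k\<close> holds the non-empty reduced words inside block
    \<open>k\<close>. \<open>T k\<close> records only the block of the first letter, which is all
    that is needed to put a word from another block in front.\<close>
  define R where "R k = {ev x vs | vs. reduced x vs \<and> vs \<noteq> [] \<and> fst ` set vs \<subseteq> S k}" for k
  define T where "T k = {ev x vs | vs. reduced x vs \<and> vs \<noteq> [] \<and> fst ` set vs \<subseteq> I \<and> fst (hd vs) \<in> S k}" for k
  have R0: "\<tau> a = 0" if "a \<in> span (R k)" for a k
    using that
  proof (induction rule: span_induct_alt)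
    case (step c b z)
    then have "\<tau> b = 0"
      using S(2)[of k] by (auto simp: R_def intro!: poly_freeD[OF free])
    with step show ?case by (simp add: tau_add tau_scale)
  qed simp
  have T0: "\<tau> a = 0" if "a \<in> span (T k)" for a k
    using that
  proof (induction rule: span_induct_alt)
    case (step c b z)
    then have "\<tau> b = 0"
      by (auto simp: T_def intro!: poly_freeD[OF free])
    with step show ?case by (simp add: tau_add tau_scale)
  qed simp
  \<comment> \<open>The empty word contributes the only scalar part, and its coefficient is the
    trace.\<close>
  have centered: "pev (?y k) p \<in> span (R k)" if "\<tau> (pev (?y k) p) = 0" for k p
  proof -
    have "reduced_words x (S k) \<subseteq> insert 1 (R k)"
      unfolding reduced_words_def R_def by force
    then have "pev (?y k) p \<in> span (insert 1 (R k))"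
      using pev_sum_in_span_reduced_words[OF S(1)] span_mono by blast
    then obtain c where c: "pev (?y k) p - scale c 1 \<in> span (R k)"
      by (auto simp: span_insert)
    from R0[OF this] that have "c = 0"
      by (simp add: tau_diff tau_scale tau_one)
    with c show ?thesis by simp
  qed
  have RT: "R k \<subseteq> T k" for k
  proof
    fix a assume "a \<in> R k"
    then obtain vs where "a = ev x vs" "reduced x vs" "vs \<noteq> []" "fst ` set vs \<subseteq> S k"
      by (auto simp: R_def)
    moreover from this have "fst (hd vs) \<in> S k" by auto
    ultimately show "a \<in> T k"
      unfolding T_def using S(2)[of k] by blast
  qed
  have main: "ev ?y ws \<in> span (T (fst (hd ws)))" if "reduced ?y ws" "ws \<noteq> []" for ws
    using that
  proof (induction ws)
    case (Cons w ws)
    obtain k p where w: "w = (k, p)" by (cases w)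
    have p: "pev (?y k) p \<in> span (R k)"
      using Cons.prems(1) by (intro centered) (simp add: w reduced_Cons)
    show ?case
    proof (cases "ws = []")
      case True
      then show ?thesis
        using p span_mono[OF RT[of k]] by (auto simp: w)
    next
      case False
      define l where "l = fst (hd ws)"
      have kl: "k \<noteq> l" and red: "reduced ?y ws"
        using Cons.prems(1) False by (auto simp: w reduced_Cons l_def)
      have "pev (?y k) p * ev ?y ws \<in> span (T k)"
      proof (rule bilinear_span[OF p Cons.IH[OF red False, folded l_def]])
        fix a b assume "a \<in> R k" "b \<in> T l"
        then obtain u v where u: "a = ev x u" "reduced x u" "u \<noteq> []" "fst ` set u \<subseteq> S k"
          and v: "b = ev x v" "reduced x v" "v \<noteq> []" "fst ` set v \<subseteq> I" "fst (hd v) \<in> S l"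
          by (auto simp: R_def T_def)
        have "fst (last u) \<in> S k" "fst (hd u) \<in> S k"
          using u(3,4) by auto
        then have "fst (last u) \<noteq> fst (hd v)" "fst (hd (u @ v)) \<in> S k"
          using v(5) disj[OF kl] u(3) by auto
        then have "a * b = ev x (u @ v) \<and> reduced x (u @ v) \<and> u @ v \<noteq> [] \<and>
            fst ` set (u @ v) \<subseteq> I \<and> fst (hd (u @ v)) \<in> S k"
          using u v S(2)[of k] by (auto simp: reduced_append image_Un)
        then show "a * b \<in> span (T k)"
          unfolding T_def by (intro span_base) blast
      qed
      then show ?thesis by (simp add: w)
    qed
  qed simp
  show ?thesis
    unfolding poly_free_def using T0[OF main] by blast
qed

section \<open>The bound for one more summand\<close>

lemma ip_pev_reduced_eq_0:
  assumes free: "poly_free I y" and self: "star (y j) = y j" and j: "j \<in> I"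
    and ws: "reduced y ws" "fst ` set ws \<subseteq> I" "ws \<noteq> []" "\<And>p. ws \<noteq> [(j, p)]"
  shows "ip (pev (y j) q) (ev y ws) = 0"
proof (cases "fst (hd ws) = j")
  case False
  then show ?thesis
    using tau_ev_pev_eq_0(2)[OF free ws(1,3,2) j] by (simp add: ip_def star_pev self)
next
  case True
  then obtain p vs where w: "ws = (j, p) # vs"
    using ws(3) by (cases ws) auto
  have "vs \<noteq> []"
    using ws(4) w by auto
  \<comment> \<open>The first letter merges with the adjoint of \<open>pev (y j) q\<close> into a
    polynomial in \<open>y j\<close>; the rest \<open>vs\<close> is non-empty and starts with
    another index.\<close>
  then have "\<tau> (pev (y j) (map_poly cnj q * p) * ev y vs) = 0"
    using ws j by (intro tau_ev_pev_eq_0(2)[OF free]) (auto simp: w reduced_Cons)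
  then show ?thesis
    by (simp add: w ip_def star_pev self pev_mult mult.assoc)
qed

lemma conj_bounded_leave_one_out:
  fixes y :: "'i \<Rightarrow> 'a"
  assumes free: "poly_free I y" and self: "\<And>i. i \<in> I \<Longrightarrow> star (y i) = y i"
    and fin: "finite I" and j: "j \<in> I"
    and law: "\<And>i j p. i \<in> I \<Longrightarrow> j \<in> I \<Longrightarrow> \<tau> (pev (y i) p) = \<tau> (pev (y j) p)"
    and bd: "conj_bounded (\<Sum>k\<in>I - {j}. y k) C" and C: "0 \<le> C"
  shows "conj_bounded (\<Sum>k\<in>I. y k) (sqrt (real (card I - 1) / real (card I)) * C)"
proof -
  \<comment> \<open>Two disjoint blocks: \<open>z True\<close> is \<open>y j\<close> and
    \<open>z False\<close> is the sum of the others. The conjugate relation for \<open>t\<close>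
    then involves just two free variables.\<close>
  define S where "S b = (if b then {j} else I - {j})" for b
  define z where "z b = (\<Sum>k\<in>S b. y k)" for b
  define t where "t = (\<Sum>k\<in>I. y k)"
  define \<rho> where "\<rho> = sqrt (real (card I - 1) / real (card I))"
  have t: "t = (\<Sum>b\<in>UNIV. z b)"
    using sum.remove[OF fin j, of y] by (simp add: t_def z_def S_def UNIV_bool add.commute)
  have s: "z False = (\<Sum>k\<in>I - {j}. y k)"
    by (simp add: z_def S_def)
  have zself: "star (z False) = z False"
    unfolding s star_sum using self by (intro sum.cong) auto
  have zfree: "poly_free UNIV z"
    unfolding z_def
    by (rule poly_free_partial_sums[OF free]) (use fin j in \<open>auto simp: S_def\<close>)
  obtain P L where cau: "(\<lambda>k. pev (z False) (P k)) \<in> cauchy2"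
    and pair: "\<forall>q. (\<lambda>k. ip (pev (z False) q) (pev (z False) (P k))) \<longlonglongrightarrow> cnj (conj_functional (z False) q)"
    and L: "(\<lambda>k. norm2 (pev (z False) (P k))) \<longlonglongrightarrow> L" "L \<le> C"
    using bd unfolding s[symmetric] by (rule conj_bounded_imp_sequence[OF _ C])
  define X where "X k = pev (z False) (P k)" for k
  \<comment> \<open>The pairing with the conjugate variable of \<open>z False\<close>, the limit of
    \<open>X\<close>, as a functional on the whole algebra.\<close>
  define \<Xi> where "\<Xi> a = lim (\<lambda>k. ip (X k) a)" for a
  have lim: "(\<lambda>k. ip (X k) a) \<longlonglongrightarrow> \<Xi> a" for a
    using ip_convergent[OF cau cauchy2_const] unfolding \<Xi>_def X_def
    by (rule convergent_LIMSEQ_iff[THEN iffD1])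
  have "\<Xi> (pev (\<Sum>b\<in>UNIV. z b) q) = conj_functional (\<Sum>b\<in>UNIV. z b) q" for q
  proof (rule functional_pev_sum[where \<Xi> = \<Xi>, OF finite zfree UNIV_I[of False]])
    show "\<Xi> (a + b) = \<Xi> a + \<Xi> b" for a b
      using tendsto_add[OF lim[of a] lim[of b]] lim[of "a + b"]
      by (intro LIMSEQ_unique) (simp_all add: ip_add_right)
    show "\<Xi> (scale c a) = c * \<Xi> a" for c a
      using tendsto_mult[OF tendsto_const lim[of a], of c] lim[of "scale c a"]
      by (intro LIMSEQ_unique) (simp_all add: ip_scale_right)
    show "\<Xi> (pev (z False) p) = conj_functional (z False) p" for p
    proof -
      have "(\<lambda>k. cnj (ip (pev (z False) p) (X k))) \<longlonglongrightarrow> cnj (cnj (conj_functional (z False) p))"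
        using pair unfolding X_def by (intro tendsto_cnj) blast
      then show ?thesis
        using lim[of "pev (z False) p"] LIMSEQ_unique
        by (simp add: ip_commute[of _ "pev (z False) p", symmetric])
    qed
    show "\<Xi> (ev z ws) = 0"
      if "reduced z ws" "fst ` set ws \<subseteq> UNIV" "ws \<noteq> []" "\<And>p. ws \<noteq> [(False, p)]" for ws
    proof -
      have "ip (X k) (ev z ws) = 0" for k
        unfolding X_def by (rule ip_pev_reduced_eq_0[where y = z, OF zfree zself UNIV_I that])
      then show ?thesis
        using lim[of "ev z ws"] by (simp add: LIMSEQ_const_iff)
    qed
  qed
  then have conj: "\<Xi> (pev t q) = conj_functional t q" for q
    by (simp add: t)
  \<comment> \<open>The difference quotient of a constant is zero, so the limit is centered and the
    product of means drops out of the correlation bound.\<close>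
  have mean: "(\<lambda>k. cnj (\<tau> (X k))) \<longlonglongrightarrow> 0"
  proof -
    have "(\<lambda>k. ip (pev (z False) 1) (X k)) \<longlonglongrightarrow> cnj (conj_functional (z False) 1)"
      using pair unfolding X_def by blast
    then have "(\<lambda>k. \<tau> (X k)) \<longlonglongrightarrow> 0"
      by (simp add: ip_def one_pCons)
    from tendsto_cnj[OF this] show ?thesis by simp
  qed
  show ?thesis
    unfolding conj_bounded_def t_def[symmetric] \<rho>_def[symmetric]
  proof
    fix q
    have "(\<lambda>k. cmod (ip (X k) (pev t q) - cnj (\<tau> (X k)) * \<tau> (pev t q)))
        \<longlonglongrightarrow> cmod (\<Xi> (pev t q) - 0 * \<tau> (pev t q))"
      by (intro tendsto_intros lim mean)
    moreover have "(\<lambda>k. \<rho> * (norm2 (X k) * norm2 (pev t q))) \<longlonglongrightarrow> \<rho> * (L * norm2 (pev t q))"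
      using L(1) unfolding X_def by (intro tendsto_intros)
    moreover have "cmod (ip (X k) (pev t q) - cnj (\<tau> (X k)) * \<tau> (pev t q))
        \<le> \<rho> * (norm2 (X k) * norm2 (pev t q))" for k
      unfolding X_def t_def \<rho>_def s
      by (rule correlation_leave_one_out[OF free self fin j law])
    ultimately have "cmod (\<Xi> (pev t q) - 0 * \<tau> (pev t q)) \<le> \<rho> * (L * norm2 (pev t q))"
      by (intro LIMSEQ_le) auto
    also have "\<dots> \<le> \<rho> * (C * norm2 (pev t q))"
      by (intro mult_left_mono mult_right_mono L(2) norm2_nonneg) (simp add: \<rho>_def)
    finally show "cmod (conj_functional t q) \<le> \<rho> * C * norm2 (pev t q)"
      by (simp add: conj)
  qed
qed

section \<open>Passage from the given hypotheses and induction on the number of summands\<close>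

lemma unital_star_subalgebra_generated: "unital_star_subalgebra (generated_star_algebra S)"
  unfolding generated_star_algebra_def
  by (rule hull_in) (auto simp: unital_star_subalgebra_def)

lemma pev_in_generated_star_algebra: "pev z p \<in> generated_star_algebra {z}"
proof -
  have z: "z \<in> generated_star_algebra {z}"
    unfolding generated_star_algebra_def by (rule hull_inc) simp
  have alg: "1 \<in> generated_star_algebra {z}"
    "\<And>a b. a \<in> generated_star_algebra {z} \<Longrightarrow> b \<in> generated_star_algebra {z} \<Longrightarrow>
      a + b \<in> generated_star_algebra {z} \<and> a * b \<in> generated_star_algebra {z}"
    "\<And>c a. a \<in> generated_star_algebra {z} \<Longrightarrow> scale c a \<in> generated_star_algebra {z}"
    using unital_star_subalgebra_generated[of "{z}"] unfolding unital_star_subalgebra_def by blast+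
  have "0 \<in> generated_star_algebra {z}"
    using alg(3)[OF alg(1), of 0] by simp
  then show ?thesis
    by (induction p) (auto intro!: alg(1,3) z alg(2)[THEN conjunct1] alg(2)[THEN conjunct2])
qed

lemma free_variables_imp_poly_free:
  assumes "free_variables I x"
  shows "poly_free I x"
  unfolding poly_free_def
proof (intro allI impI)
  fix ws :: "('b \<times> complex poly) list"
  assume ws: "reduced x ws" "ws \<noteq> []" "fst ` set ws \<subseteq> I"
  define i where "i k = fst (ws ! k)" for k
  define a where "a k = pev (x (i k)) (snd (ws ! k))" for k
  have "length ws \<ge> 1"
    using ws(2) by (cases ws) auto
  moreover have "i k \<in> I \<and> a k \<in> generated_star_algebra {x (i k)} \<and> \<tau> (a k) = 0"
    if "k < length ws" for k
    using ws that nth_mem[OF that] unfolding reduced_def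
    by (auto simp: i_def a_def pev_in_generated_star_algebra split_def)
  moreover have "i k \<noteq> i (Suc k)" if "Suc k < length ws" for k
    using ws(1) that unfolding reduced_def distinct_adj_conv_nth by (auto simp: i_def)
  ultimately have "\<tau> (prod_list (map a [0..<length ws])) = 0"
    using assms unfolding free_variables_def free_subalgebras_def by blast
  moreover have "map a [0..<length ws] = map (\<lambda>(i, p). pev (x i) p) ws"
    by (rule nth_equalityI) (simp_all add: a_def i_def split_def)
  ultimately show "\<tau> (ev x ws) = 0"
    by (simp add: ev_def)
qed

lemma identically_distributed_pev:
  assumes "identically_distributed I x" "i \<in> I" "j \<in> I"
  shows "\<tau> (pev (x i) p) = \<tau> (pev (x j) p)"
proof -
  have "\<tau> (x i ^ k) = \<tau> (x j ^ k)" for k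
  proof (cases "k = 0")
    case False
    then have "1 \<le> k" by simp
    with assms show ?thesis
      unfolding identically_distributed_def by blast
  qed simp
  then show ?thesis
    by (simp add: pev_altdef tau_sum tau_scale tau_add)
qed

text \<open>Going from \<open>n\<close> to \<open>n + 1\<close> summands multiplies the constant by
  \<open>sqrt (n / (n + 1))\<close>, which turns \<open>C / sqrt n\<close> into
  \<open>C / sqrt (n + 1)\<close>.\<close>

lemma conj_bounded_partial_sums_mono:
  assumes free: "poly_free {1..} x" and self: "\<And>i. 1 \<le> i \<Longrightarrow> star (x i) = x i"
    and law: "\<And>i j p. 1 \<le> i \<Longrightarrow> 1 \<le> j \<Longrightarrow> \<tau> (pev (x i) p) = \<tau> (pev (x j) p)"
    and bd: "conj_bounded (\<Sum>i=1..m. x i) (C / sqrt (real m))" and C: "0 \<le> C"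
    and "1 \<le> m" "m \<le> (n :: nat)"
  shows "conj_bounded (\<Sum>i=1..n. x i) (C / sqrt (real n))"
  using \<open>m \<le> n\<close>
proof (induction n rule: dec_induct)
  case (step n)
  let ?I = "{1..Suc n}"
  have I: "?I - {Suc n} = {1..n}"
    by auto
  have free': "poly_free ?I x"
    using free unfolding poly_free_def by fastforce
  have "conj_bounded (\<Sum>k\<in>?I. x k)
      (sqrt (real (card ?I - 1) / real (card ?I)) * (C / sqrt (real n)))"
  proof (rule conj_bounded_leave_one_out[OF free'])
    show "conj_bounded (\<Sum>k\<in>?I - {Suc n}. x k) (C / sqrt (real n))"
      unfolding I by (rule step.IH)
  qed (use C in \<open>auto intro: self law\<close>)
  moreover have "sqrt (real (card ?I - 1) / real (card ?I)) * (C / sqrt (real n)) = C / sqrt (real (Suc n))"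
    using \<open>1 \<le> m\<close> step.hyps by (simp add: real_sqrt_divide)
  ultimately show ?case by simp
qed (use bd in simp)

theorem free_Fisher_partial_sums_mono:
  assumes "free_variables {1..} x" and self: "\<And>i. 1 \<le> i \<Longrightarrow> star (x i) = x i"
    and "identically_distributed {1..} x" and mn: "1 \<le> m" "m \<le> (n :: nat)"
  shows "free_Fisher (scale (1 / of_real (sqrt (real n))) (\<Sum>i=1..n. x i))
    \<le> free_Fisher (scale (1 / of_real (sqrt (real m))) (\<Sum>i=1..m. x i))"
proof -
  define z where "z k = scale (of_real (1 / sqrt (real k))) (\<Sum>i=1..k. x i)" for k
  have zself: "star (z k) = z k" for k
    unfolding z_def star_scale star_sum using self by simp
  \<comment> \<open>By homogeneity, the bound \<open>C / sqrt k\<close> for the sum is the bound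
    \<open>C\<close> for the normalised sum, so one constant serves for all
    \<open>k\<close>.\<close>
  have iff: "conj_bounded (z k) C \<longleftrightarrow> conj_bounded (\<Sum>i=1..k. x i) (C / sqrt (real k))" if "1 \<le> k" for k C
    unfolding z_def using conj_bounded_scale_iff[of "1 / sqrt (real k)"] that by simp
  have "free_Fisher (z n) \<le> free_Fisher (z m)"
  proof (cases "free_Fisher (z m)" rule: ennreal_cases)
    case (real r)
    have "conj_bounded (z m) (sqrt r)"
      using real by (intro free_Fisher_le_imp_conj_bounded zself) auto
    then have bd: "conj_bounded (\<Sum>i=1..m. x i) (sqrt r / sqrt (real m))"
      by (simp only: iff[OF mn(1)])
    have "conj_bounded (\<Sum>i=1..n. x i) (sqrt r / sqrt (real n))"
    proof (rule conj_bounded_partial_sums_mono[OF _ self _ bd _ mn])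
      show "poly_free {1..} x"
        by (rule free_variables_imp_poly_free[OF assms(1)])
      show "\<tau> (pev (x i) p) = \<tau> (pev (x j) p)" if "1 \<le> i" "1 \<le> j" for i j p
        by (rule identically_distributed_pev[OF assms(3)]) (use that in auto)
    qed (use real in auto)
    then have "conj_bounded (z n) (sqrt r)"
      using mn by (simp only: iff[OF order_trans[OF mn]])
    then have "free_Fisher (z n) \<le> ennreal ((sqrt r)\<^sup>2)"
      using real by (intro conj_bounded_imp_free_Fisher_le zself) auto
    then show ?thesis
      using real by simp
  qed simp
  then show ?thesis
    by (simp add: z_def)
qed

end

theorem corollary3p1:
  fixes scale :: "complex \<Rightarrow> 'a::ring_1 \<Rightarrow> 'a"
    and star :: "'a \<Rightarrow> 'a"
    and \<tau> :: "'a \<Rightarrow> complex"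
    and x :: "nat \<Rightarrow> 'a"
    and s :: "nat \<Rightarrow> 'a"
    and m n :: nat
  assumes "tracial_space scale star \<tau>"
    and "\<And>i. i \<ge> 1 \<Longrightarrow> star (x i) = x i"
    and "tracial_space.free_variables scale star \<tau> {1..} x"
    and "tracial_space.identically_distributed \<tau> {1..} x"
    and "\<And>k. k \<ge> 1 \<Longrightarrow> s k = (\<Sum>i=1..k. x i)"
    and "1 \<le> m" and "m \<le> n"
  shows "tracial_space.free_Fisher scale star \<tau> (scale (1 / complex_of_real (sqrt (real n))) (s n))
       \<le> tracial_space.free_Fisher scale star \<tau> (scale (1 / complex_of_real (sqrt (real m))) (s m))"
proof -
  have "s n = (\<Sum>i=1..n. x i)" "s m = (\<Sum>i=1..m. x i)"
    using assms(5-7) by auto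
  then show ?thesis
    using tracial_space.free_Fisher_partial_sums_mono[OF assms(1,3,2,4,6,7)] by simp
qed

end
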